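(* Let $f\in\mathcal{N}_\Psi(\Omega)$ be fixed, observations noiseless ($y_k=f(x_k)$), $x_1,\dots,x_n$ i.i.d. uniform on $\Omega$, $\hat\mu_n\asymp n^\alpha$ with $\alpha<1$, and $\Psi$ satisfying the spectral condition. Then for all $n$, with probability at least $1-C_1\exp(-C_2n^{\eta_1})$, $$\|f-\hat f_n\|_{L_\infty(\Omega)}^2\le C_3\max\Big(n^{(\alpha-1)(1-\frac{d}{2\nu})},\,n^{-(1-\frac{d}{2\nu})}\Big),$$ where $C_1,C_2,C_3,\eta_1>0$ depend on $\Psi,\Omega,f$.
   Context: $\Omega\subset\mathbb{R}^d$ convex and compact with positive Lebesgue measure. $\Psi$ stationary, strictly positive definite, integrable, $\Psi(0)=1$, with spectral density $f_\Psi$ ($\Psi(h)=\int e^{i\omega^Th}f_\Psi(\omega)d\omega$) satisfying $c_1(1+\|\omega\|_2^2)^{-\nu}\le f_\Psi(\omega)\le c_2(1+\|\omega\|_2^2)^{-\nu}$ ($c_2\ge c_1>0$, $\nu>d/2$). $\mathcal{N}_\Psi(\Omega)$ is the RKHS of $\Psi$ on $\Omega$. $\hat\mu_n>0$ deterministic; $Y=(f(x_k))_k$; $r(x)=(\Psi(x-x_k))_k$, $R=(\Psi(x_j-x_k))_{jk}$; $\hat f_n(x)=r(x)^T(R+\hat\mu_nI_n)^{-1}Y$. *)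

theory Defs
  imports "HOL-Probability.Probability"
begin

definition kcomb :: "('a::euclidean_space \<Rightarrow> real) \<Rightarrow> (real \<times> 'a) list \<Rightarrow> 'a \<Rightarrow> real" where
  "kcomb \<Psi> cs x = (\<Sum>(a,z)\<leftarrow>cs. a * \<Psi> (x - z))"

definition knorm2 :: "('a::euclidean_space \<Rightarrow> real) \<Rightarrow> (real \<times> 'a) list \<Rightarrow> real" where
  "knorm2 \<Psi> cs = (\<Sum>(a,z)\<leftarrow>cs. \<Sum>(b,w)\<leftarrow>cs. a * b * \<Psi> (z - w))"

definition kneg :: "(real \<times> 'a) list \<Rightarrow> (real \<times> 'a) list" where
  "kneg cs = map (\<lambda>(a,z). (- a, z)) cs"

text \<open>Native space (RKHS) N_Psi(Omega), Moore-Aronszajn construction: pointwise limits on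
  Omega of Cauchy sequences (in the pre-Hilbert norm) of finite kernel combinations
  centred in Omega.\<close>
definition native_space :: "('a::euclidean_space \<Rightarrow> real) \<Rightarrow> 'a set \<Rightarrow> ('a \<Rightarrow> real) set" where
  "native_space \<Psi> \<Omega> = {f. \<exists>S :: nat \<Rightarrow> (real \<times> 'a) list.
      (\<forall>m. snd ` set (S m) \<subseteq> \<Omega>) \<and>
      (\<forall>x\<in>\<Omega>. (\<lambda>m. kcomb \<Psi> (S m) x) \<longlonglongrightarrow> f x) \<and>
      (\<forall>e>0. \<exists>N. \<forall>m\<ge>N. \<forall>k\<ge>N. knorm2 \<Psi> (S m @ kneg (S k)) < e)}"

definition strictly_pos_def :: "('a::euclidean_space \<Rightarrow> real) \<Rightarrow> bool" where
  "strictly_pos_def \<Psi> \<longleftrightarrow> (\<forall>(m::nat) (z::nat \<Rightarrow> 'a) (c::nat \<Rightarrow> real).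
      inj_on z {..<m} \<longrightarrow> (\<exists>j<m. c j \<noteq> 0) \<longrightarrow>
      (\<Sum>j<m. \<Sum>k<m. c j * c k * \<Psi> (z j - z k)) > 0)"

definition spectral_density :: "('a::euclidean_space \<Rightarrow> real) \<Rightarrow> ('a \<Rightarrow> real) \<Rightarrow> bool" where
  "spectral_density \<Psi> f\<Psi> \<longleftrightarrow> integrable lborel f\<Psi> \<and> (\<forall>\<omega>. f\<Psi> \<omega> \<ge> 0) \<and>
     (\<forall>h. complex_of_real (\<Psi> h) =
        integral\<^sup>L lborel (\<lambda>\<omega>. exp (\<i> * complex_of_real (\<omega> \<bullet> h)) * complex_of_real (f\<Psi> \<omega>)))"

text \<open>Coefficient vector c = (R + mu I)^{-1} Y, written as the unique solution of the linear
  system (indices 0..n-1; c is 0 outside).\<close>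
definition krr_coef :: "('a::euclidean_space \<Rightarrow> real) \<Rightarrow> real \<Rightarrow> nat \<Rightarrow> (nat \<Rightarrow> 'a) \<Rightarrow> (nat \<Rightarrow> real) \<Rightarrow> nat \<Rightarrow> real" where
  "krr_coef \<Psi> \<mu> n X Y = (THE c. (\<forall>k\<ge>n. c k = 0) \<and>
      (\<forall>j<n. (\<Sum>k<n. \<Psi> (X j - X k) * c k) + \<mu> * c j = Y j))"

definition krr_est :: "('a::euclidean_space \<Rightarrow> real) \<Rightarrow> real \<Rightarrow> nat \<Rightarrow> (nat \<Rightarrow> 'a) \<Rightarrow> ('a \<Rightarrow> real) \<Rightarrow> 'a \<Rightarrow> real" where
  "krr_est \<Psi> \<mu> n X f x = (\<Sum>k<n. \<Psi> (x - X k) * krr_coef \<Psi> \<mu> n X (\<lambda>k. f (X k)) k)"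

definition sample_space :: "'a::euclidean_space set \<Rightarrow> nat \<Rightarrow> (nat \<Rightarrow> 'a) measure" where
  "sample_space \<Omega> n = PiM {..<n} (\<lambda>_. uniform_measure lborel \<Omega>)"

end

theory Submission
  imports Defs
begin

text \<open>
  Let \<open>e = f - f\<^sub>n\<close>, \<open>r\<^sup>2\<^sup>\<nu> = max (n\<^bsup>\<alpha>-1\<^esup>) (n\<^bsup>-1\<^esup>)\<close> and \<open>s = r\<^bsup>\<nu>-d/2\<^esup>\<close>; the claimed rate is \<open>s\<^sup>2\<close>.
  The normal equations give \<open>\<parallel>e\<parallel>\<^sup>2 \<le> B\<close> and \<open>\<Sum>\<^sub>j e(x\<^sub>j)\<^sup>2 \<le> \<mu> B\<close> with \<open>B\<close> depending on \<open>f\<close> only.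
  Near any \<open>x \<in> \<Omega>\<close>, cutting the spectrum of \<open>e\<close> off at \<open>1/r\<close> and Taylor expanding the low
  frequencies shows that \<open>e\<close> differs on a ball of radius \<open>O(r)\<close> from a polynomial \<open>q\<close> by \<open>O(s)\<close>.
  By convexity a ball of radius comparable to \<open>r\<close> within distance \<open>O(r)\<close> of \<open>x\<close> lies in \<open>\<Omega>\<close>. With
  probability \<open>1 - O(exp (- c n\<^sup>p))\<close>, \<open>p = 1 - d/(2\<nu>)\<close>, every subcell of it at a fixed fraction of
  the scale \<open>r\<close> contains at least \<open>c n r\<^sup>d \<ge> c n\<^sup>p\<close> sample points, and therefore one at which
  \<open>e\<^sup>2 = O(\<mu> / (n r\<^sup>d)) = O(s\<^sup>2)\<close>. So \<open>q = O(s)\<close> on a norming set of the ball, hence on the ball,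
  hence at \<open>x\<close>.
\<close>

section \<open>Norming sets for polynomials\<close>

text \<open>Induction on the degree: subtracting a rescaled copy of the polynomial removes the
  leading term and multiplies every other coefficient by a factor of modulus at least 1, so the
  induction hypothesis bounds those; the leading coefficient is then read off at
  \<open>t = 1\<close>.\<close>

lemma poly_coeff_bound:
  "\<exists>C\<ge>1. \<forall>(a :: nat \<Rightarrow> 'v::real_normed_vector) M.
     (\<forall>t\<in>{0..1}. norm (\<Sum>j\<le>m. t ^ j *\<^sub>R a j) \<le> M) \<longrightarrow> (\<forall>j\<le>m. norm (a j) \<le> C * M)"
proof (induction m)
  case 0
  show ?case by (rule exI[of _ 1]) auto
next
  case (Suc m)
  then obtain C where C: "C \<ge> 1" and
    IH: "\<And>(a :: nat \<Rightarrow> 'v) M. (\<forall>t\<in>{0..1}. norm (\<Sum>j\<le>m. t ^ j *\<^sub>R a j) \<le> M) \<Longrightarrow> \<forall>j\<le>m. norm (a j) \<le> C * M"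
    by blast
  define K where "K = C * (1 + 2 ^ Suc m)"
  have K: "K \<ge> 1" unfolding K_def using C mult_mono[of 1 C 1 "1 + 2 ^ Suc m"] by auto
  show ?case
  proof (intro exI[of _ "1 + real (Suc m) * K"] conjI allI impI)
    show "1 \<le> 1 + real (Suc m) * K" using K by auto
    fix a :: "nat \<Rightarrow> 'v" and M j
    assume b: "\<forall>t\<in>{0..1}. norm (\<Sum>j\<le>Suc m. t ^ j *\<^sub>R a j) \<le> M" and j: "j \<le> Suc m"
    have "norm (\<Sum>j\<le>Suc m. 0 ^ j *\<^sub>R a j) \<le> M" using b by (intro b[rule_format]) auto
    then have M: "M \<ge> 0" using norm_ge_zero order_trans by blast
    \<comment> \<open>The leading term cancels in \<open>P(t) - 2\<^bsup>m+1\<^esup> P(t/2)\<close>.\<close>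
    define c where "c j = (1 - 2 ^ (Suc m - j)) *\<^sub>R a j" for j
    have "norm (\<Sum>j\<le>m. t ^ j *\<^sub>R c j) \<le> (1 + 2 ^ Suc m) * M" if t: "t \<in> {0..1}" for t
    proof -
      have "(\<Sum>j\<le>m. t ^ j *\<^sub>R c j) = (\<Sum>j\<le>Suc m. t ^ j *\<^sub>R c j)"
        by (simp add: c_def)
      also have "\<dots> = (\<Sum>j\<le>Suc m. t ^ j *\<^sub>R a j - 2 ^ Suc m *\<^sub>R (t/2) ^ j *\<^sub>R a j)"
      proof (rule sum.cong)
        fix j assume "j \<in> {..Suc m}"
        then have "(2::real) ^ Suc m = 2 ^ (Suc m - j) * 2 ^ j"
          by (simp flip: power_add)
        then show "t ^ j *\<^sub>R c j = t ^ j *\<^sub>R a j - 2 ^ Suc m *\<^sub>R (t/2) ^ j *\<^sub>R a j"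
          unfolding c_def by (simp add: power_divide algebra_simps)
      qed simp
      also have "\<dots> = (\<Sum>j\<le>Suc m. t ^ j *\<^sub>R a j) - 2 ^ Suc m *\<^sub>R (\<Sum>j\<le>Suc m. (t/2) ^ j *\<^sub>R a j)"
        by (simp only: sum_subtractf scaleR_sum_right)
      also have "norm \<dots> \<le> M + 2 ^ Suc m * M"
        using b t by (intro order_trans[OF norm_triangle_ineq4] add_mono)
          (auto simp del: sum.atMost_Suc power_Suc intro!: mult_left_mono)
      finally show ?thesis by (simp add: algebra_simps)
    qed
    then have cb: "\<forall>j\<le>m. norm (c j) \<le> C * ((1 + 2 ^ Suc m) * M)"
      by (intro IH) blast
    have lo: "norm (a j) \<le> K * M" if "j \<le> m" for j
    proof -
      have "(2::real) ^ 1 \<le> 2 ^ (Suc m - j)" using that by (intro power_increasing) auto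
      then have "1 * norm (a j) \<le> \<bar>1 - 2 ^ (Suc m - j)\<bar> * norm (a j)"
        by (intro mult_right_mono) auto
      also have "\<dots> = norm (c j)" by (simp add: c_def)
      also have "\<dots> \<le> K * M" using cb that by (simp add: K_def mult.assoc)
      finally show ?thesis by simp
    qed
    have "a (Suc m) = (\<Sum>j\<le>Suc m. 1 ^ j *\<^sub>R a j) - (\<Sum>j\<le>m. a j)" by simp
    also have "norm \<dots> \<le> M + (\<Sum>j\<le>m. K * M)"
      using b[rule_format, of 1] lo
      by (intro order_trans[OF norm_triangle_ineq4] add_mono sum_norm_le) auto
    also have "\<dots> = (1 + real (Suc m) * K) * M" by (simp add: algebra_simps)
    finally have hi: "norm (a (Suc m)) \<le> (1 + real (Suc m) * K) * M" .
    have "K \<le> 1 + real (Suc m) * K" using K by (auto simp: algebra_simps)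
    then have "K * M \<le> (1 + real (Suc m) * K) * M" using M by (rule mult_right_mono)
    then show "norm (a j) \<le> (1 + real (Suc m) * K) * M"
      using lo[of j] hi j by (cases "j = Suc m") auto
  qed
qed

text \<open>Being a polynomial on every line is all that is needed of a multivariate polynomial.\<close>
definition line_poly :: "nat \<Rightarrow> ('a::real_vector \<Rightarrow> 'v::real_vector) \<Rightarrow> bool" where
  "line_poly m q \<longleftrightarrow> (\<forall>u w. \<exists>a. \<forall>t::real. q (u + t *\<^sub>R w) = (\<Sum>j\<le>m. t ^ j *\<^sub>R a j))"

text \<open>On the ray from \<open>c\<close> through \<open>y\<close> the function is a polynomial
  of degree at most \<open>m\<close>, bounded by \<open>M\<close> for parameters in [0,1]. Its
  coefficients are therefore O(M), and evaluating at parameter \<open>L\<close> costs at most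
  \<open>L ^ m\<close>.\<close>

lemma line_poly_extrapolate:
  "\<exists>C\<ge>1. \<forall>(q :: 'a::euclidean_space \<Rightarrow> 'v::real_normed_vector) c \<rho> M L y.
     line_poly m q \<longrightarrow> L \<ge> 1 \<longrightarrow> (\<forall>y\<in>cball c \<rho>. norm (q y) \<le> M) \<longrightarrow>
     y \<in> cball c (L * \<rho>) \<longrightarrow> norm (q y) \<le> C * L ^ m * M"
proof -
  obtain C where C: "C \<ge> 1" and
    bd: "\<And>(a :: nat \<Rightarrow> 'v) M. (\<forall>t\<in>{0..1}. norm (\<Sum>j\<le>m. t ^ j *\<^sub>R a j) \<le> M) \<Longrightarrow> \<forall>j\<le>m. norm (a j) \<le> C * M"
    using poly_coeff_bound[of m] by blast
  show ?thesis
  proof (intro exI[of _ "real (Suc m) * C"] conjI allI impI)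
    show "1 \<le> real (Suc m) * C" using C mult_mono[of 1 "real (Suc m)" 1 C] by auto
    fix q :: "'a \<Rightarrow> 'v" and c \<rho> M L y
    assume q: "line_poly m q" and l: "L \<ge> (1::real)" and b: "\<forall>y\<in>cball c \<rho>. norm (q y) \<le> M"
      and y: "y \<in> cball c (L * \<rho>)"
    define w where "w = (y - c) /\<^sub>R L"
    have w: "norm w \<le> \<rho>" using y l
      by (simp add: w_def dist_norm norm_minus_commute[of c] divide_simps mult.commute)
    obtain a where a: "\<And>t::real. q (c + t *\<^sub>R w) = (\<Sum>j\<le>m. t ^ j *\<^sub>R a j)"
      using q unfolding line_poly_def by blast
    have "\<forall>t\<in>{0..1}. norm (\<Sum>j\<le>m. t ^ j *\<^sub>R a j) \<le> M"
    proof
      fix t :: real assume t: "t \<in> {0..1}"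
      have "t * norm w \<le> 1 * \<rho>" using t w by (intro mult_mono) auto
      then show "norm (\<Sum>j\<le>m. t ^ j *\<^sub>R a j) \<le> M"
        using t unfolding a[symmetric] by (intro b[rule_format]) (auto simp: dist_norm)
    qed
    from bd[OF this] have ab: "\<forall>j\<le>m. norm (a j) \<le> C * M" .
    then have CM: "0 \<le> C * M" using norm_ge_zero order_trans by blast
    have "y = c + L *\<^sub>R w" using l by (simp add: w_def)
    then have "q y = (\<Sum>j\<le>m. L ^ j *\<^sub>R a j)" using a[of L] by simp
    also have "norm \<dots> \<le> (\<Sum>j\<le>m. L ^ m * (C * M))"
      using l ab CM by (intro sum_norm_le) (auto intro!: mult_mono power_increasing)
    also have "\<dots> = real (Suc m) * C * L ^ m * M" by simp
    finally show "norm (q y) \<le> real (Suc m) * C * L ^ m * M" .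
  qed
qed

text \<open>A Markov-type inequality. The line from \<open>u\<close> towards \<open>v\<close>, run
  at speed \<open>\<rho>\<close>, may leave the ball during times in [0,1], but it stays in the
  concentric ball of twice the radius, where extrapolation with factor 2 still bounds
  \<open>q\<close>.\<close>

lemma line_poly_lipschitz:
  "\<exists>K>0. \<forall>(q :: 'a::euclidean_space \<Rightarrow> 'v::real_normed_vector) c \<rho> M u v.
     line_poly m q \<longrightarrow> \<rho> > 0 \<longrightarrow> (\<forall>y\<in>cball c \<rho>. norm (q y) \<le> M) \<longrightarrow>
     u \<in> cball c \<rho> \<longrightarrow> v \<in> cball c \<rho> \<longrightarrow> norm (q u - q v) \<le> K * M * (norm (u - v) / \<rho>)"
proof -
  obtain C where C: "C \<ge> 1" and
    bd: "\<And>(a :: nat \<Rightarrow> 'v) M. (\<forall>t\<in>{0..1}. norm (\<Sum>j\<le>m. t ^ j *\<^sub>R a j) \<le> M) \<Longrightarrow> \<forall>j\<le>m. norm (a j) \<le> C * M"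
    using poly_coeff_bound[of m] by blast
  obtain E where E: "E \<ge> 1" and
    ex: "\<And>(q :: 'a \<Rightarrow> 'v) c \<rho> M L y.
     line_poly m q \<Longrightarrow> L \<ge> 1 \<Longrightarrow> (\<forall>y\<in>cball c \<rho>. norm (q y) \<le> M) \<Longrightarrow>
     y \<in> cball c (L * \<rho>) \<Longrightarrow> norm (q y) \<le> E * L ^ m * M"
    using line_poly_extrapolate[of m] by blast
  define K where "K = real (Suc m) * 2 ^ m * (C * (E * 2 ^ m))"
  show ?thesis
  proof (intro exI[of _ K] conjI allI impI)
    show "K > 0" using C E by (auto simp: K_def)
    fix q :: "'a \<Rightarrow> 'v" and c \<rho> M u v
    assume q: "line_poly m q" and \<rho>: "\<rho> > (0::real)" and b: "\<forall>y\<in>cball c \<rho>. norm (q y) \<le> M"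
      and u: "u \<in> cball c \<rho>" and v: "v \<in> cball c \<rho>"
    show "norm (q u - q v) \<le> K * M * (norm (u - v) / \<rho>)"
    proof (cases "u = v")
      case False
      \<comment> \<open>The time at which the line through \<open>u\<close> with direction of norm
        \<open>\<rho>\<close> reaches \<open>v\<close>; it is at most 2 since both points lie in the
        ball.\<close>
      define \<tau> where "\<tau> = norm (u - v) / \<rho>"
      have \<tau>: "0 < \<tau>" using False \<rho> by (auto simp: \<tau>_def)
      have "norm (u - v) \<le> \<rho> + \<rho>"
        using dist_triangle_le[of u c v "\<rho> + \<rho>"] u v by (simp add: dist_commute dist_norm)
      then have \<tau>2: "\<tau> \<le> 2" using \<rho> by (auto simp: \<tau>_def field_simps)
      define w where "w = (v - u) /\<^sub>R \<tau>"
      have w: "norm w = \<rho>" using \<tau> False \<rho> by (auto simp: w_def \<tau>_def norm_minus_commute)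
      obtain a where a: "\<And>t::real. q (u + t *\<^sub>R w) = (\<Sum>j\<le>m. t ^ j *\<^sub>R a j)"
        using q unfolding line_poly_def by blast
      have "\<forall>t\<in>{0..1}. norm (\<Sum>j\<le>m. t ^ j *\<^sub>R a j) \<le> E * 2 ^ m * M"
      proof
        fix t :: real assume t: "t \<in> {0..1}"
        have "t * norm w \<le> 1 * \<rho>" using t w \<rho> by (intro mult_mono) auto
        then have "dist c (u + t *\<^sub>R w) \<le> 2 * \<rho>"
          using u t dist_triangle_le[of c u "u + t *\<^sub>R w" "2 * \<rho>"] by (auto simp: dist_norm)
        then show "norm (\<Sum>j\<le>m. t ^ j *\<^sub>R a j) \<le> E * 2 ^ m * M"
          unfolding a[symmetric] using b by (intro ex[OF q]) auto
      qed
      from bd[OF this] have ab: "\<forall>j\<le>m. norm (a j) \<le> C * (E * 2 ^ m * M)" .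
      then have CM: "0 \<le> C * (E * 2 ^ m * M)" using norm_ge_zero order_trans by blast
      have qv: "q v = (\<Sum>j\<le>m. \<tau> ^ j *\<^sub>R a j)" using a[of \<tau>] \<tau> by (simp add: w_def)
      \<comment> \<open>Since \<open>0 ^ 0 = 1\<close>, the same formula covers time 0; in the
        difference the constant terms cancel and every remaining term carries a factor
        \<open>\<tau>\<close>.\<close>
      have qu: "q u = (\<Sum>j\<le>m. 0 ^ j *\<^sub>R a j)" using a[of 0] by simp
      have "norm (q v - q u) = norm (\<Sum>j\<le>m. (\<tau> ^ j - 0 ^ j) *\<^sub>R a j)"
        unfolding qv qu by (simp only: sum_subtractf scaleR_left_diff_distrib)
      also have "\<dots> \<le> (\<Sum>j\<le>m. (2 ^ m * \<tau>) * (C * (E * 2 ^ m * M)))"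
      proof (rule sum_norm_le)
        fix j assume j: "j \<in> {..m}"
        have "\<bar>\<tau> ^ j - 0 ^ j\<bar> \<le> 2 ^ m * \<tau>"
        proof (cases j)
          case 0 then show ?thesis using \<tau> by simp
        next
          case (Suc i)
          have "\<tau> ^ i \<le> 2 ^ i" using \<tau> \<tau>2 by (intro power_mono) auto
          also have "(2::real) ^ i \<le> 2 ^ m" using j Suc by (intro power_increasing) auto
          finally show ?thesis using Suc \<tau> by simp
        qed
        then show "norm ((\<tau> ^ j - 0 ^ j) *\<^sub>R a j) \<le> (2 ^ m * \<tau>) * (C * (E * 2 ^ m * M))"
          using ab j \<tau> unfolding norm_scaleR by (intro mult_mono) auto
      qed
      also have "\<dots> = K * M * \<tau>" by (simp add: K_def)
      finally show ?thesis by (simp add: \<tau>_def norm_minus_commute)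
    qed simp
  qed
qed

text \<open>Absorption: if \<open>M\<close> is the supremum of \<open>norm (q y)\<close> over the
  ball, moving from any point to a nearby good one changes \<open>q\<close> by at most
  \<open>K * M * \<epsilon> \<le> M / 2\<close>, hence \<open>M \<le> s + M / 2\<close>. Boundedness
  makes \<open>M\<close> finite, so that \<open>M / 2\<close> can be subtracted.\<close>

lemma line_poly_norming:
  "\<exists>\<epsilon>>0. \<epsilon> \<le> 1 \<and> (\<forall>(q :: 'a::euclidean_space \<Rightarrow> 'v::real_normed_vector) c \<rho> s.
     line_poly m q \<longrightarrow> bounded (q ` cball c \<rho>) \<longrightarrow> \<rho> > 0 \<longrightarrow>
     (\<forall>u\<in>cball c \<rho>. \<exists>v\<in>cball c \<rho>. norm (u - v) \<le> \<epsilon> * \<rho> \<and> norm (q v) \<le> s) \<longrightarrow>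
     (\<forall>u\<in>cball c \<rho>. norm (q u) \<le> 2 * s))"
proof -
  obtain K where K: "K > 0" and lip: "\<And>(q :: 'a \<Rightarrow> 'v) c \<rho> M u v.
     line_poly m q \<Longrightarrow> \<rho> > 0 \<Longrightarrow> (\<forall>y\<in>cball c \<rho>. norm (q y) \<le> M) \<Longrightarrow>
     u \<in> cball c \<rho> \<Longrightarrow> v \<in> cball c \<rho> \<Longrightarrow> norm (q u - q v) \<le> K * M * (norm (u - v) / \<rho>)"
    using line_poly_lipschitz[of m] by blast
  \<comment> \<open>The second entry gives \<open>K * \<epsilon> \<le> 1/2\<close>; the first keeps
    the contraction factor \<open>1 - \<epsilon> / 2\<close> nonnegative when sample points are
    sought inside the ball.\<close>
  define \<epsilon> where "\<epsilon> = min 1 (1 / (2 * K))"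
  have e: "\<epsilon> > 0" "\<epsilon> \<le> 1" "K * \<epsilon> \<le> 1/2"
    using K by (auto simp: \<epsilon>_def min_def field_simps)
  show ?thesis
  proof (intro exI[of _ \<epsilon>] conjI allI impI e)
    fix q :: "'a \<Rightarrow> 'v" and c \<rho> s
    assume q: "line_poly m q" and bdd: "bounded (q ` cball c \<rho>)" and \<rho>: "\<rho> > (0::real)"
      and ne: "\<forall>u\<in>cball c \<rho>. \<exists>v\<in>cball c \<rho>. norm (u - v) \<le> \<epsilon> * \<rho> \<and> norm (q v) \<le> s"
    define M where "M = (SUP y\<in>cball c \<rho>. norm (q y))"
    have M: "\<forall>y\<in>cball c \<rho>. norm (q y) \<le> M"
      unfolding M_def using bdd
      by (auto intro!: cSUP_upper simp: bounded_iff bdd_above_def)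
    have "norm (q c) \<le> M" using M \<rho> by auto
    then have M0: "M \<ge> 0" using norm_ge_zero order_trans by blast
    have "norm (q u) \<le> s + M / 2" if u: "u \<in> cball c \<rho>" for u
    proof -
      obtain v where v: "v \<in> cball c \<rho>" "norm (u - v) \<le> \<epsilon> * \<rho>" "norm (q v) \<le> s"
        using ne u by blast
      have "norm (q u - q v) \<le> K * M * (norm (u - v) / \<rho>)"
        by (rule lip[OF q \<rho> M u v(1)])
      also have "\<dots> \<le> K * M * \<epsilon>"
        using v(2) \<rho> K M0 by (intro mult_left_mono) (auto simp: field_simps)
      also have "\<dots> \<le> M / 2"
        using mult_right_mono[OF e(3) M0] by (simp add: mult_ac)
      finally show ?thesis
        using norm_triangle_sub[of "q u" "q v"] v(3) by simp
    qed
    then have "M \<le> s + M / 2"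
      unfolding M_def using \<rho> by (intro cSUP_least) auto
    then show "\<forall>u\<in>cball c \<rho>. norm (q u) \<le> 2 * s" using M by fastforce
  qed
qed

section \<open>Kernel combinations in the Fourier domain\<close>

text \<open>The Fourier transform of the discrete measure with mass a at each z. Multiplied by the
  spectral density it is the transform of the kernel combination.\<close>

definition kfourier :: "(real \<times> 'a::euclidean_space) list \<Rightarrow> 'a \<Rightarrow> complex" where
  "kfourier cs \<omega> = (\<Sum>(a,z)\<leftarrow>cs. complex_of_real a * iexp (- (\<omega> \<bullet> z)))"

lemma kfourier_simps [simp]:
  "kfourier [] \<omega> = 0"
  "kfourier ((a,z) # cs) \<omega> = complex_of_real a * iexp (- (\<omega> \<bullet> z)) + kfourier cs \<omega>"
  by (simp_all add: kfourier_def)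

lemma borel_measurable_kfourier [measurable]: "kfourier cs \<in> borel_measurable borel"
proof (induction cs)
  case (Cons x cs)
  obtain a z where "x = (a, z)" by force
  then show ?case using Cons by (simp cong: measurable_cong_simp)
qed (simp cong: measurable_cong_simp)

lemma kfourier_bounded: "\<exists>B\<ge>0. \<forall>\<omega>. cmod (kfourier cs \<omega>) \<le> B"
proof (induction cs)
  case (Cons x cs)
  obtain a z where x: "x = (a, z)" by force
  from Cons obtain B where B: "B \<ge> 0" "\<forall>\<omega>. cmod (kfourier cs \<omega>) \<le> B" by blast
  show ?case
    using B by (intro exI[of _ "\<bar>a\<bar> + B"])
      (auto simp: x norm_mult intro!: order_trans[OF norm_triangle_ineq] add_mono)
qed (auto intro!: exI[of _ 0])

lemma kcomb_Nil [simp]: "kcomb \<Psi> [] x = 0"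
  and kcomb_Cons [simp]: "kcomb \<Psi> ((a,z) # cs) x = a * \<Psi> (x - z) + kcomb \<Psi> cs x"
  and kcomb_append [simp]: "kcomb \<Psi> (cs @ ds) x = kcomb \<Psi> cs x + kcomb \<Psi> ds x"
  by (simp_all add: kcomb_def)

lemma kcomb_kneg [simp]: "kcomb \<Psi> (kneg cs) x = - kcomb \<Psi> cs x"
  by (induction cs) (auto simp: kneg_def)

lemma knorm2_eq_kcomb: "knorm2 \<Psi> cs = (\<Sum>(a,z)\<leftarrow>cs. a * kcomb \<Psi> cs z)"
  unfolding knorm2_def kcomb_def
  by (intro arg_cong[where f=sum_list] map_cong refl)
    (auto simp: sum_list_const_mult[symmetric] mult.assoc case_prod_unfold)

locale spectral_kernel =
  fixes \<Psi> f\<Psi> :: "'a::euclidean_space \<Rightarrow> real"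
  assumes spectral: "spectral_density \<Psi> f\<Psi>"
begin

lemma density_integrable [intro, simp]: "integrable lborel f\<Psi>"
  and density_nonneg [simp]: "f\<Psi> \<omega> \<ge> 0"
  and kernel_fourier: "complex_of_real (\<Psi> h) = (LINT \<omega>|lborel. iexp (\<omega> \<bullet> h) * complex_of_real (f\<Psi> \<omega>))"
  using spectral unfolding spectral_density_def by auto

lemma density_measurable [measurable]: "f\<Psi> \<in> borel_measurable borel"
  using borel_measurable_integrable[OF density_integrable] by simp

lemma integrable_density_bounded:
  fixes g :: "'a \<Rightarrow> complex"
  assumes "g \<in> borel_measurable borel" and "\<And>\<omega>. cmod (g \<omega>) \<le> B"
  shows "integrable lborel (\<lambda>\<omega>. f\<Psi> \<omega> *\<^sub>R g \<omega>)"
proof (rule Bochner_Integration.integrable_bound)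
  show "integrable lborel (\<lambda>\<omega>. B * f\<Psi> \<omega>)" by auto
  show "AE \<omega> in lborel. norm (f\<Psi> \<omega> *\<^sub>R g \<omega>) \<le> norm (B * f\<Psi> \<omega>)"
  proof (intro AE_I2)
    fix \<omega>
    have "f\<Psi> \<omega> * cmod (g \<omega>) \<le> f\<Psi> \<omega> * B" using assms(2) by (intro mult_left_mono) auto
    also have "\<dots> \<le> \<bar>B * f\<Psi> \<omega>\<bar>" by (simp add: mult.commute)
    finally show "norm (f\<Psi> \<omega> *\<^sub>R g \<omega>) \<le> norm (B * f\<Psi> \<omega>)" by simp
  qed
qed (use assms in measurable)

lemma kernel_eq_integral: "complex_of_real (\<Psi> h) = (LINT \<omega>|lborel. f\<Psi> \<omega> *\<^sub>R iexp (\<omega> \<bullet> h))"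
  by (subst kernel_fourier) (simp add: scaleR_conv_of_real mult.commute)

text \<open>\<open>\<Psi>\<close> is real, hence equal to its conjugate, and conjugating the Fourier
  integral reverses the sign of \<open>h\<close>.\<close>

lemma kernel_symmetric: "\<Psi> (- h) = \<Psi> h"
proof -
  have "complex_of_real (\<Psi> h) = cnj (LINT \<omega>|lborel. f\<Psi> \<omega> *\<^sub>R iexp (\<omega> \<bullet> h))"
    using kernel_eq_integral[of h] by (metis complex_cnj_complex_of_real)
  also have "\<dots> = (LINT \<omega>|lborel. f\<Psi> \<omega> *\<^sub>R iexp (\<omega> \<bullet> (- h)))"
    by (subst integral_bounded_linear[OF bounded_linear_cnj, symmetric])
       (auto simp: exp_cnj intro!: integrable_density_bounded[where B=1])
  also have "\<dots> = complex_of_real (\<Psi> (- h))" by (rule kernel_eq_integral[symmetric])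
  finally show ?thesis by simp
qed

lemma kernel_commute: "\<Psi> (x - y) = \<Psi> (y - x)"
  using kernel_symmetric[of "x - y"] by simp

lemma integral_density: "integral\<^sup>L lborel f\<Psi> = \<Psi> 0"
  using kernel_eq_integral[of 0] by (simp add: scaleR_conv_of_real)

lemma kcomb_fourier:
  "complex_of_real (kcomb \<Psi> cs y) = (LINT \<omega>|lborel. f\<Psi> \<omega> *\<^sub>R (iexp (\<omega> \<bullet> y) * kfourier cs \<omega>))"
proof (induction cs)
  case (Cons x cs)
  obtain a z where x: "x = (a, z)" by force
  obtain B where B: "B \<ge> 0" "\<forall>\<omega>. cmod (kfourier cs \<omega>) \<le> B" using kfourier_bounded by blast
  have i1: "integrable lborel (\<lambda>\<omega>. f\<Psi> \<omega> *\<^sub>R iexp (\<omega> \<bullet> (y - z)))"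
    by (rule integrable_density_bounded[where B=1]) auto
  have i2: "integrable lborel (\<lambda>\<omega>. f\<Psi> \<omega> *\<^sub>R (iexp (\<omega> \<bullet> y) * kfourier cs \<omega>))"
    using B by (intro integrable_density_bounded[where B=B]) (auto simp: norm_mult)
  have "complex_of_real (kcomb \<Psi> (x # cs) y) =
     a *\<^sub>R (LINT \<omega>|lborel. f\<Psi> \<omega> *\<^sub>R iexp (\<omega> \<bullet> (y - z))) + (LINT \<omega>|lborel. f\<Psi> \<omega> *\<^sub>R (iexp (\<omega> \<bullet> y) * kfourier cs \<omega>))"
    using Cons kernel_eq_integral[of "y - z"] by (simp add: x scaleR_conv_of_real)
  also have "\<dots> = (LINT \<omega>|lborel. a *\<^sub>R (f\<Psi> \<omega> *\<^sub>R iexp (\<omega> \<bullet> (y - z))) + f\<Psi> \<omega> *\<^sub>R (iexp (\<omega> \<bullet> y) * kfourier cs \<omega>))"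
    using i1 i2 by (subst Bochner_Integration.integral_add) (simp_all del: scaleR_scaleR)
  also have "\<dots> = (LINT \<omega>|lborel. f\<Psi> \<omega> *\<^sub>R (iexp (\<omega> \<bullet> y) * kfourier (x # cs) \<omega>))"
    by (intro Bochner_Integration.integral_cong)
       (auto simp: x scaleR_conv_of_real inner_diff_right ring_distribs exp_add[symmetric] exp_diff exp_minus divide_simps)
  finally show ?case .
qed simp

text \<open>Parseval: the native norm is a weighted L2 norm of the transform. It yields positive
  semidefiniteness and lets the spectral bounds act on the norm.\<close>

lemma knorm2_fourier:
  "knorm2 \<Psi> cs = (LINT \<omega>|lborel. f\<Psi> \<omega> * (cmod (kfourier cs \<omega>))\<^sup>2)"
proof -
  obtain B where B: "B \<ge> 0" "\<forall>\<omega>. cmod (kfourier cs \<omega>) \<le> B" using kfourier_bounded by blast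
  have [measurable]: "cnj \<in> borel_measurable borel"
    by (intro borel_measurable_continuous_onI continuous_intros)
  \<comment> \<open>The two occurrences of the list are decoupled: the sesquilinear form is additive
    in \<open>ds\<close> while \<open>cs\<close> stays fixed, which permits an induction;
    \<open>ds = cs\<close> gives the norm.\<close>
  have "complex_of_real (\<Sum>(a,z)\<leftarrow>ds. a * kcomb \<Psi> cs z) =
      (LINT \<omega>|lborel. f\<Psi> \<omega> *\<^sub>R (cnj (kfourier ds \<omega>) * kfourier cs \<omega>))" for ds
  proof (induction ds)
    case (Cons x ds)
    obtain a z where x: "x = (a, z)" by force
    obtain D where D: "D \<ge> 0" "\<forall>\<omega>. cmod (kfourier ds \<omega>) \<le> D" using kfourier_bounded by blast
    have i1: "integrable lborel (\<lambda>\<omega>. f\<Psi> \<omega> *\<^sub>R (iexp (\<omega> \<bullet> z) * kfourier cs \<omega>))"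
      using B by (intro integrable_density_bounded[where B=B]) (auto simp: norm_mult)
    have i2: "integrable lborel (\<lambda>\<omega>. f\<Psi> \<omega> *\<^sub>R (cnj (kfourier ds \<omega>) * kfourier cs \<omega>))"
      using B D by (intro integrable_density_bounded[where B="D*B"]) (auto simp: norm_mult intro!: mult_mono)
    have "complex_of_real (\<Sum>(a,z)\<leftarrow>x#ds. a * kcomb \<Psi> cs z) =
       a *\<^sub>R (LINT \<omega>|lborel. f\<Psi> \<omega> *\<^sub>R (iexp (\<omega> \<bullet> z) * kfourier cs \<omega>)) + (LINT \<omega>|lborel. f\<Psi> \<omega> *\<^sub>R (cnj (kfourier ds \<omega>) * kfourier cs \<omega>))"
      using Cons kcomb_fourier[of cs z] by (simp add: x scaleR_conv_of_real)
    also have "\<dots> = (LINT \<omega>|lborel. a *\<^sub>R (f\<Psi> \<omega> *\<^sub>R (iexp (\<omega> \<bullet> z) * kfourier cs \<omega>)) + f\<Psi> \<omega> *\<^sub>R (cnj (kfourier ds \<omega>) * kfourier cs \<omega>))"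
      using i1 i2 by (subst Bochner_Integration.integral_add) (simp_all del: scaleR_scaleR)
    also have "\<dots> = (LINT \<omega>|lborel. f\<Psi> \<omega> *\<^sub>R (cnj (kfourier (x # ds) \<omega>) * kfourier cs \<omega>))"
      by (intro Bochner_Integration.integral_cong)
         (auto simp: x scaleR_conv_of_real algebra_simps exp_cnj)
    finally show ?case .
  qed simp
  then have "complex_of_real (knorm2 \<Psi> cs) = (LINT \<omega>|lborel. f\<Psi> \<omega> *\<^sub>R (cnj (kfourier cs \<omega>) * kfourier cs \<omega>))"
    by (simp add: knorm2_eq_kcomb)
  also have "\<dots> = (LINT \<omega>|lborel. complex_of_real (f\<Psi> \<omega> * (cmod (kfourier cs \<omega>))\<^sup>2))"
    by (intro Bochner_Integration.integral_cong refl)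
       (simp add: scaleR_conv_of_real complex_norm_square mult.commute del: of_real_power)
  also have "\<dots> = complex_of_real (LINT \<omega>|lborel. f\<Psi> \<omega> * (cmod (kfourier cs \<omega>))\<^sup>2)"
    by (rule integral_complex_of_real)
  finally show ?thesis by (simp only: of_real_eq_iff)
qed

lemma knorm2_nonneg: "knorm2 \<Psi> cs \<ge> 0"
  unfolding knorm2_fourier by (intro integral_nonneg_AE) auto

lemma kcomb_cross_commute:
  "(\<Sum>(a,z)\<leftarrow>cs. a * kcomb \<Psi> ds z) = (\<Sum>(b,w)\<leftarrow>ds. b * kcomb \<Psi> cs w)"
proof (induction cs)
  case (Cons x cs)
  obtain a z where x: "x = (a, z)" by force
  have "a * kcomb \<Psi> ds z = (\<Sum>(b,w)\<leftarrow>ds. b * (a * \<Psi> (w - z)))"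
    by (induction ds) (auto simp: algebra_simps kernel_commute[of z])
  with Cons show ?case
    by (simp add: x distrib_left case_prod_unfold sum_list_addf)
qed (simp add: case_prod_unfold)

lemma knorm2_diff:
  "knorm2 \<Psi> (cs @ kneg ds) = knorm2 \<Psi> cs - 2 * (\<Sum>(b,w)\<leftarrow>ds. b * kcomb \<Psi> cs w) + knorm2 \<Psi> ds"
proof -
  have neg: "(\<Sum>(b,w)\<leftarrow>kneg ds. b * g w) = - (\<Sum>(b,w)\<leftarrow>ds. b * g w)" for g
    by (induction ds) (auto simp: kneg_def)
  have "(\<Sum>(a,z)\<leftarrow>es. a * (g z - h z)) = (\<Sum>(a,z)\<leftarrow>es. a * g z) - (\<Sum>(a,z)\<leftarrow>es. a * (h z::real))"
    for es :: "(real \<times> 'a) list" and g h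
    by (induction es) (auto simp: algebra_simps)
  note sub = this
  show ?thesis
    unfolding knorm2_eq_kcomb
    by (simp add: neg sub kcomb_cross_commute[of cs ds])
qed

text \<open>Equivalent to nonnegativity of the squared norm of \<open>cs\<close> minus twice
  \<open>ds\<close>; the doubled combination is written \<open>ds @ ds\<close>.\<close>

lemma knorm2_le_double: "knorm2 \<Psi> cs \<le> 2 * knorm2 \<Psi> (cs @ kneg ds) + 2 * knorm2 \<Psi> ds"
proof -
  have "knorm2 \<Psi> (cs @ kneg (ds @ ds)) = knorm2 \<Psi> cs - 4 * (\<Sum>(b,w)\<leftarrow>ds. b * kcomb \<Psi> cs w) + 4 * knorm2 \<Psi> ds"
  proof -
    have "(\<Sum>(b,w)\<leftarrow>es. b * (2 * g w)) = 2 * (\<Sum>(b,w)\<leftarrow>es. b * (g w :: real))"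
      for es :: "(real \<times> 'a) list" and g
      by (induction es) auto
    then show ?thesis
      unfolding knorm2_diff by (simp add: knorm2_eq_kcomb)
  qed
  with knorm2_nonneg[of "cs @ kneg (ds @ ds)"] show ?thesis
    by (simp add: knorm2_diff)
qed

end

section \<open>Local polynomial approximation by frequency cut-off\<close>

lemma integrable_lborel_scale:
  fixes f :: "'a::euclidean_space \<Rightarrow> real"
  assumes f: "integrable lborel f" and r: "r > 0"
  shows "integrable lborel (\<lambda>x. f (r *\<^sub>R x))"
    and "(LINT x|lborel. f (r *\<^sub>R x)) = integral\<^sup>L lborel f / r ^ DIM('a)"
proof -
  have [measurable]: "f \<in> borel_measurable borel" using borel_measurable_integrable[OF f] by simp
  have eq: "lborel = density (distr lborel borel (\<lambda>x::'a. r *\<^sub>R x)) (\<lambda>_. ennreal (r ^ DIM('a)))"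
    using lborel_affine[of r "0::'a"] r by simp
  have "integrable (distr lborel borel (\<lambda>x::'a. r *\<^sub>R x)) (\<lambda>x. r ^ DIM('a) *\<^sub>R f x)"
    using f r by (subst (asm) eq, subst (asm) integrable_density) auto
  then have "integrable lborel (\<lambda>x. r ^ DIM('a) *\<^sub>R f (r *\<^sub>R x))"
    by (subst (asm) integrable_distr_eq) auto
  then show "integrable lborel (\<lambda>x. f (r *\<^sub>R x))" using r by simp
  have "integral\<^sup>L lborel f = (LINT x|distr lborel borel (\<lambda>x::'a. r *\<^sub>R x). r ^ DIM('a) *\<^sub>R f x)"
    using r by (subst eq, subst integral_density) auto
  also have "\<dots> = (LINT x|lborel. r ^ DIM('a) *\<^sub>R f (r *\<^sub>R x))"
    by (subst integral_distr) auto
  finally show "(LINT x|lborel. f (r *\<^sub>R x)) = integral\<^sup>L lborel f / r ^ DIM('a)"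
    using r by (simp add: field_simps)
qed

definition exp_taylor :: "nat \<Rightarrow> real \<Rightarrow> complex" where
  "exp_taylor m x = (\<Sum>k\<le>m. (\<i> * complex_of_real x) ^ k / fact k)"

text \<open>The binomial expansion sorted by powers of \<open>t\<close>. The coefficients of these
  powers do not involve \<open>t\<close>, so integrating them over the frequencies yields the
  coefficients of a polynomial on the line.\<close>

lemma exp_taylor_line:
  "exp_taylor m (\<alpha> + t * \<beta>) = (\<Sum>l\<le>m. t ^ l *\<^sub>R
     (\<Sum>k\<le>m. if l \<le> k then of_nat (k choose l) * (\<i> * complex_of_real \<beta>) ^ l * (\<i> * complex_of_real \<alpha>) ^ (k - l) / fact k else 0))"
proof -
  have "(\<i> * complex_of_real (\<alpha> + t * \<beta>)) ^ k / fact k = (\<Sum>l\<le>m. t ^ l *\<^sub>R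
     (if l \<le> k then of_nat (k choose l) * (\<i> * complex_of_real \<beta>) ^ l * (\<i> * complex_of_real \<alpha>) ^ (k - l) / fact k else 0))"
    if "k \<le> m" for k
  proof -
    have "(\<i> * complex_of_real (\<alpha> + t * \<beta>)) ^ k / fact k =
        (t *\<^sub>R (\<i> * complex_of_real \<beta>) + \<i> * complex_of_real \<alpha>) ^ k / fact k"
      by (simp add: scaleR_conv_of_real algebra_simps)
    also have "\<dots> = (\<Sum>l\<le>k. t ^ l *\<^sub>R
     (of_nat (k choose l) * (\<i> * complex_of_real \<beta>) ^ l * (\<i> * complex_of_real \<alpha>) ^ (k - l) / fact k))"
      unfolding binomial_ring sum_divide_distrib
      by (intro sum.cong refl) (simp add: scaleR_conv_of_real power_mult_distrib)
    also have "\<dots> = (\<Sum>l\<le>m. t ^ l *\<^sub>R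
     (if l \<le> k then of_nat (k choose l) * (\<i> * complex_of_real \<beta>) ^ l * (\<i> * complex_of_real \<alpha>) ^ (k - l) / fact k else 0))"
      using that by (intro sum.mono_neutral_cong_left) auto
    finally show ?thesis .
  qed
  then have "exp_taylor m (\<alpha> + t * \<beta>) = (\<Sum>k\<le>m. \<Sum>l\<le>m. t ^ l *\<^sub>R
     (if l \<le> k then of_nat (k choose l) * (\<i> * complex_of_real \<beta>) ^ l * (\<i> * complex_of_real \<alpha>) ^ (k - l) / fact k else 0))"
    unfolding exp_taylor_def by (intro sum.cong) auto
  also have "\<dots> = (\<Sum>l\<le>m. t ^ l *\<^sub>R
     (\<Sum>k\<le>m. if l \<le> k then of_nat (k choose l) * (\<i> * complex_of_real \<beta>) ^ l * (\<i> * complex_of_real \<alpha>) ^ (k - l) / fact k else 0))"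
    by (subst sum.swap) (simp only: scaleR_sum_right)
  finally show ?thesis .
qed

text \<open>Put \<open>u = r * \<rho>\<close>. For \<open>u \<le> 1\<close> the factor
  \<open>u ^ (2 * M)\<close> compensates \<open>u powr (- (2 * \<nu>))\<close> because
  \<open>\<nu> \<le> M\<close>, and \<open>1 + u\<^sup>2 \<le> 2\<close>; for \<open>u > 1\<close>
  one uses \<open>1 + u\<^sup>2 \<le> 2 * u\<^sup>2\<close>. Both cases end in the weight at the
  rescaled frequency, whose integral is known.\<close>

lemma sobolev_weight_scaling:
  fixes \<rho> \<nu> D r :: real
  assumes "\<rho> \<ge> 0" "0 < r" "0 < \<nu>" "\<nu> \<le> real M" "D \<ge> 1"
  shows "(1 + \<rho>\<^sup>2) powr (- \<nu>) * (if \<rho> \<le> 1 / r then (\<rho> * D * r) ^ M else 1)\<^sup>2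
     \<le> D ^ (2 * M) * 2 powr \<nu> * r powr (2 * \<nu>) * (1 + (r * \<rho>)\<^sup>2) powr (- \<nu>)"
proof (cases "\<rho> = 0")
  case True
  \<comment> \<open>A positive exponent makes the left side vanish at frequency 0; with exponent 0
    the factor would be \<open>0 ^ 0 = 1\<close>.\<close>
  have "M > 0" using assms by (auto intro: gr0I)
  then show ?thesis using True assms by (simp add: zero_power)
next
  case False
  then have \<rho>: "\<rho> > 0" using assms by auto
  define u where "u = r * \<rho>"
  have u: "u > 0" using \<rho> assms by (auto simp: u_def)
  have sq: "(y\<^sup>2) powr (- \<nu>) = y powr (- (2 * \<nu>))" if "y > 0" for y :: real
    using that powr_powr[of y 2 "-\<nu>"] by simp
  have "(1 + \<rho>\<^sup>2) powr (- \<nu>) \<le> (\<rho>\<^sup>2) powr (- \<nu>)"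
    using \<rho> assms by (intro powr_mono2') auto
  also have "\<dots> = \<rho> powr (- (2 * \<nu>))" using sq \<rho> by auto
  also have "\<dots> = r powr (2 * \<nu>) * u powr (- (2 * \<nu>))"
    unfolding u_def using \<rho> assms by (simp add: powr_mult powr_minus)
  finally have w: "(1 + \<rho>\<^sup>2) powr (- \<nu>) \<le> r powr (2 * \<nu>) * u powr (- (2 * \<nu>))" .
  have key: "u powr (- (2 * \<nu>)) * (if \<rho> \<le> 1 / r then (\<rho> * D * r) ^ M else 1)\<^sup>2
     \<le> D ^ (2 * M) * (2 powr \<nu> * (1 + u\<^sup>2) powr (- \<nu>))"
  proof (cases "\<rho> \<le> 1 / r")
    case True
    then have u1: "u \<le> 1" using assms by (auto simp: u_def field_simps)
    have "u powr (- (2 * \<nu>)) * (if \<rho> \<le> 1 / r then (\<rho> * D * r) ^ M else 1)\<^sup>2 =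
        D ^ (2 * M) * (u powr (- (2 * \<nu>)) * u powr (real (2 * M)))"
      using True u unfolding powr_realpow[OF u] by (simp add: u_def power_mult_distrib power_mult mult_ac flip: power_mult)
    also have "u powr (- (2 * \<nu>)) * u powr (real (2 * M)) = u powr (real (2*M) - 2 * \<nu>)"
      by (simp flip: powr_add)
    also have "\<dots> \<le> u powr 0" using u u1 assms by (intro powr_mono') auto
    also have "\<dots> = 2 powr \<nu> * 2 powr (- \<nu>)" using u by (simp add: powr_minus)
    also have "\<dots> \<le> 2 powr \<nu> * (1 + u\<^sup>2) powr (- \<nu>)"
      using u u1 assms by (intro mult_left_mono powr_mono2') (auto simp: power_le_one_iff add_pos_nonneg)
    finally show ?thesis using assms by auto
  next
    case False
    then have u1: "u > 1" using assms by (auto simp: u_def field_simps)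
    have "u powr (- (2 * \<nu>)) = 2 powr \<nu> * (2 * u\<^sup>2) powr (- \<nu>)"
      using u sq[of u] by (simp add: powr_mult powr_minus)
    also have "\<dots> \<le> 2 powr \<nu> * (1 + u\<^sup>2) powr (- \<nu>)"
      using u u1 assms by (intro mult_left_mono powr_mono2') (auto simp: add_pos_nonneg)
    also have "\<dots> \<le> D ^ (2 * M) * \<dots>"
      using assms mult_right_mono[of 1 "D ^ (2 * M)" "2 powr \<nu> * (1 + u\<^sup>2) powr (- \<nu>)"] by auto
    finally show ?thesis using False by simp
  qed
  have "(1 + \<rho>\<^sup>2) powr (- \<nu>) * (if \<rho> \<le> 1 / r then (\<rho> * D * r) ^ M else 1)\<^sup>2
     \<le> (r powr (2 * \<nu>) * u powr (- (2 * \<nu>))) * (if \<rho> \<le> 1 / r then (\<rho> * D * r) ^ M else 1)\<^sup>2"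
    by (intro mult_right_mono w) auto
  also have "\<dots> \<le> r powr (2 * \<nu>) * (D ^ (2 * M) * (2 powr \<nu> * (1 + u\<^sup>2) powr (- \<nu>)))"
    using mult_left_mono[OF key, of "r powr (2 * \<nu>)"] by (simp add: mult_ac)
  finally show ?thesis by (simp add: u_def mult_ac)
qed

locale sobolev_kernel = spectral_kernel \<Psi> f\<Psi> for \<Psi> f\<Psi> :: "'a::euclidean_space \<Rightarrow> real" +
  fixes c1 c2 \<nu> :: real
  assumes c1: "0 < c1" and nu: "\<nu> > real DIM('a) / 2" and kernel_0: "\<Psi> 0 = 1"
    and density_lower: "c1 * (1 + norm \<omega> ^ 2) powr (- \<nu>) \<le> f\<Psi> \<omega>"
    and density_upper: "f\<Psi> \<omega> \<le> c2 * (1 + norm \<omega> ^ 2) powr (- \<nu>)"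
begin

lemma nu_pos: "\<nu> > 0"
  using nu DIM_positive[where 'a='a] by (smt (verit) divide_pos_pos of_nat_0_less_iff)

text \<open>\<open>q\<close> keeps the frequencies up to \<open>1 / r\<close> and replaces the
  exponential in \<open>y - x\<close> by its Taylor polynomial. The error is an integral of density
  times transform times a majorant \<open>H\<close>. Young's inequality splits it into the native
  norm and the integral of density times \<open>H\<^sup>2\<close>, so the bound is linear in
  \<open>knorm2\<close> rather than in its root.\<close>

lemma kcomb_local_poly:
  assumes m: "\<nu> \<le> real (Suc m)" and D: "D \<ge> 1"
  shows "\<exists>C\<ge>0. \<forall>cs r x. 0 < r \<longrightarrow> r \<le> 1 \<longrightarrow> (\<exists>q :: 'a \<Rightarrow> complex. line_poly m q \<and>
    bounded (q ` cball x (D * r)) \<and>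
    (\<forall>y\<in>cball x (D * r). cmod (complex_of_real (kcomb \<Psi> cs y) - q y)
        \<le> (knorm2 \<Psi> cs + C) * r powr (\<nu> - real DIM('a) / 2)))"
proof -
  \<comment> \<open>\<open>c2 / c1\<close> is the price of passing from the density to the Sobolev
    weight and back; the other factors come from \<open>sobolev_weight_scaling\<close> with exponent
    \<open>Suc m\<close>.\<close>
  define K where "K = c2 / c1 * D ^ (2 * Suc m) * 2 powr \<nu>"
  \<comment> \<open>Comparing the two spectral bounds at frequency 0 shows that \<open>c2\<close> is
    positive.\<close>
  have "0 < c1 * (1 + norm (0::'a) ^ 2) powr (- \<nu>)" using c1 by simp
  also have "\<dots> \<le> c2 * (1 + norm (0::'a) ^ 2) powr (- \<nu>)"
    using density_lower density_upper order_trans by blast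
  finally have c2: "c2 > 0" by (simp add: zero_less_mult_iff)
  have K: "K \<ge> 0" using c1 c2 D by (auto simp: K_def)
  show ?thesis
  proof (intro exI[of _ K] conjI allI impI K)
    fix cs :: "(real \<times> 'a) list" and r :: real and x :: 'a
    assume r: "0 < r" "r \<le> 1"
    obtain B where B: "B \<ge> 0" "\<And>\<omega>. cmod (kfourier cs \<omega>) \<le> B" using kfourier_bounded by blast
    define I where "I \<omega> = (indicator (cball 0 (1 / r)) \<omega> :: real)" for \<omega> :: 'a
    have [measurable]: "I \<in> borel_measurable borel" unfolding I_def by (intro borel_measurable_indicator) auto
    \<comment> \<open>The low-frequency part re-centred at \<open>x\<close>, with a free factor
      \<open>g\<close> that will be the Taylor polynomial or one of its coefficients along a line.
      The cut-off confines \<open>\<omega>\<close> to a compact ball, so any continuous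
      \<open>g\<close> is harmless for integrability.\<close>
    define G where "G g \<omega> = I \<omega> *\<^sub>R (iexp (\<omega> \<bullet> x) * kfourier cs \<omega> * g \<omega>)" for g \<omega>
    have Gint: "integrable lborel (\<lambda>\<omega>. f\<Psi> \<omega> *\<^sub>R G g \<omega>)" if g: "continuous_on UNIV g" for g
    proof -
      have "bounded (g ` cball 0 (1/r))"
        by (intro compact_imp_bounded compact_continuous_image continuous_on_subset[OF g]) auto
      then obtain E where E: "\<And>\<omega>. \<omega> \<in> cball 0 (1/r) \<Longrightarrow> cmod (g \<omega>) \<le> E"
        unfolding bounded_iff by blast
      have [measurable]: "g \<in> borel_measurable borel" using g by (rule borel_measurable_continuous_onI)
      show ?thesis
      proof (rule integrable_density_bounded[where B = "B * \<bar>E\<bar>"])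
        fix \<omega>
        show "cmod (G g \<omega>) \<le> B * \<bar>E\<bar>"
          using B E[of \<omega>] unfolding G_def I_def
          by (auto simp: norm_mult indicator_def intro!: mult_mono)
      qed (simp add: G_def)
    qed
    define q where "q y = (LINT \<omega>|lborel. f\<Psi> \<omega> *\<^sub>R G (\<lambda>\<omega>. exp_taylor m (\<omega> \<bullet> (y - x))) \<omega>)" for y
    have lp: "line_poly m q"
      unfolding line_poly_def
    proof (intro allI)
      fix u w
      define g where "g l \<omega> = (\<Sum>k\<le>m. if l \<le> k then of_nat (k choose l) * (\<i> * complex_of_real (\<omega> \<bullet> w)) ^ l
           * (\<i> * complex_of_real (\<omega> \<bullet> (u - x))) ^ (k - l) / fact k else 0)" for l \<omega>
      have gc: "continuous_on UNIV (g l)" for l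
        unfolding g_def
      proof (intro continuous_on_sum)
        fix k
        show "continuous_on UNIV (\<lambda>\<omega>. if l \<le> k then of_nat (k choose l) * (\<i> * complex_of_real (\<omega> \<bullet> w)) ^ l
           * (\<i> * complex_of_real (\<omega> \<bullet> (u - x))) ^ (k - l) / fact k else 0)"
          by (cases "l \<le> k") (auto intro!: continuous_intros)
      qed
      have "q (u + t *\<^sub>R w) = (\<Sum>l\<le>m. t ^ l *\<^sub>R (LINT \<omega>|lborel. f\<Psi> \<omega> *\<^sub>R G (g l) \<omega>))" for t
      proof -
        have "exp_taylor m (\<omega> \<bullet> (u + t *\<^sub>R w - x)) = (\<Sum>l\<le>m. t ^ l *\<^sub>R g l \<omega>)" for \<omega>
          using exp_taylor_line[of m "\<omega> \<bullet> (u - x)" t "\<omega> \<bullet> w"]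
          by (simp add: g_def inner_add_right inner_diff_right add_diff_eq[symmetric] diff_add_eq)
        then have "q (u + t *\<^sub>R w) = (LINT \<omega>|lborel. (\<Sum>l\<le>m. t ^ l *\<^sub>R (f\<Psi> \<omega> *\<^sub>R G (g l) \<omega>)))"
          unfolding q_def
          by (intro Bochner_Integration.integral_cong refl)
            (simp add: G_def sum_distrib_left scaleR_sum_right mult_ac)
        also have "\<dots> = (\<Sum>l\<le>m. t ^ l *\<^sub>R (LINT \<omega>|lborel. f\<Psi> \<omega> *\<^sub>R G (g l) \<omega>))"
          by (subst Bochner_Integration.integral_sum) (use Gint[OF gc] in \<open>auto simp del: scaleR_scaleR\<close>)
        finally show ?thesis .
      qed
      then show "\<exists>a. \<forall>t. q (u + t *\<^sub>R w) = (\<Sum>j\<le>m. t ^ j *\<^sub>R a j)"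
        by (intro exI[of _ "\<lambda>l. LINT \<omega>|lborel. f\<Psi> \<omega> *\<^sub>R G (g l) \<omega>"]) blast
    qed
    define s where "s = r powr (\<nu> - real DIM('a) / 2)"
    have s: "s > 0" using r by (simp add: s_def)
    \<comment> \<open>Majorant of the replacement error: the Taylor remainder below the cut-off,
      where the phase is at most \<open>norm \<omega> * D * r\<close>, and the trivial bound 1 above
      it, where nothing is kept.\<close>
    define H where "H \<omega> = (if norm \<omega> \<le> 1 / r then (norm \<omega> * D * r) ^ Suc m else 1)" for \<omega> :: 'a
    have H0: "H \<omega> \<ge> 0" for \<omega> using D r by (auto simp: H_def)
    \<comment> \<open>Upper spectral bound at \<open>\<omega>\<close>, rescaling of the weight, then
      the lower spectral bound at \<open>r *\<^sub>R \<omega>\<close>: the majorant becomes a dilate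
      of the density itself.\<close>
    have fH: "f\<Psi> \<omega> * (H \<omega>)\<^sup>2 \<le> K * r powr (2 * \<nu>) * f\<Psi> (r *\<^sub>R \<omega>)" for \<omega>
    proof -
      have "f\<Psi> \<omega> * (H \<omega>)\<^sup>2 \<le> c2 * (1 + norm \<omega> ^ 2) powr (- \<nu>) * (H \<omega>)\<^sup>2"
        by (intro mult_right_mono density_upper) auto
      also have "\<dots> \<le> c2 * (D ^ (2 * Suc m) * 2 powr \<nu> * r powr (2 * \<nu>) * (1 + (r * norm \<omega>)\<^sup>2) powr (- \<nu>))"
        using sobolev_weight_scaling[OF norm_ge_zero r(1) nu_pos m D, of \<omega>] c2
        unfolding H_def mult.assoc[of c2] by (intro mult_left_mono) auto
      also have "\<dots> = K * r powr (2 * \<nu>) * (c1 * (1 + norm (r *\<^sub>R \<omega>) ^ 2) powr (- \<nu>))"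
        using c1 r by (simp add: K_def)
      also have "\<dots> \<le> K * r powr (2 * \<nu>) * f\<Psi> (r *\<^sub>R \<omega>)"
        using K by (intro mult_left_mono density_lower) auto
      finally show ?thesis .
    qed
    have int1: "integrable lborel (\<lambda>\<omega>. f\<Psi> \<omega> * (cmod (kfourier cs \<omega>))\<^sup>2)"
    proof -
      have "integrable lborel (\<lambda>\<omega>. f\<Psi> \<omega> *\<^sub>R complex_of_real ((cmod (kfourier cs \<omega>))\<^sup>2))"
        using B by (intro integrable_density_bounded[where B="B\<^sup>2"]) (auto simp: norm_power intro!: power_mono)
      then have "integrable lborel (\<lambda>\<omega>. complex_of_real (f\<Psi> \<omega> * (cmod (kfourier cs \<omega>))\<^sup>2))"
        by (simp add: scaleR_conv_of_real)
      then show ?thesis by (simp only: complex_of_real_integrable_eq)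
    qed
    have near: "cmod (complex_of_real (kcomb \<Psi> cs y) - q y) \<le> (knorm2 \<Psi> cs + K) * s"
      if y: "y \<in> cball x (D * r)" for y
    proof -
      have i1: "integrable lborel (\<lambda>\<omega>. f\<Psi> \<omega> *\<^sub>R (iexp (\<omega> \<bullet> y) * kfourier cs \<omega>))"
        using B by (intro integrable_density_bounded[where B=B]) (auto simp: norm_mult)
      have i2: "integrable lborel (\<lambda>\<omega>. f\<Psi> \<omega> *\<^sub>R G (\<lambda>\<omega>. exp_taylor m (\<omega> \<bullet> (y - x))) \<omega>)"
        by (intro Gint) (auto simp: exp_taylor_def intro!: continuous_intros)
      have "complex_of_real (kcomb \<Psi> cs y) - q y = (LINT \<omega>|lborel.
          f\<Psi> \<omega> *\<^sub>R (iexp (\<omega> \<bullet> y) * kfourier cs \<omega>) - f\<Psi> \<omega> *\<^sub>R G (\<lambda>\<omega>. exp_taylor m (\<omega> \<bullet> (y - x))) \<omega>)"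
        unfolding q_def kcomb_fourier using i1 i2 by simp
      also have "cmod \<dots> \<le> (LINT \<omega>|lborel. (s * (f\<Psi> \<omega> * (cmod (kfourier cs \<omega>))\<^sup>2)
            + K * r powr (2 * \<nu>) / s * f\<Psi> (r *\<^sub>R \<omega>)) / 2)"
      proof (rule Bochner_Integration.integral_norm_bound_integral)
        show "integrable lborel (\<lambda>\<omega>. (s * (f\<Psi> \<omega> * (cmod (kfourier cs \<omega>))\<^sup>2)
            + K * r powr (2 * \<nu>) / s * f\<Psi> (r *\<^sub>R \<omega>)) / 2)"
          using int1 integrable_lborel_scale(1)[OF density_integrable r(1)] by (intro integrable_divide integrable_add integrable_mult_right) auto
        fix \<omega> :: 'a
        have "cmod (iexp (\<omega> \<bullet> y) * kfourier cs \<omega> - G (\<lambda>\<omega>. exp_taylor m (\<omega> \<bullet> (y - x))) \<omega>) \<le> cmod (kfourier cs \<omega>) * H \<omega>"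
        proof (cases "norm \<omega> \<le> 1 / r")
          case True
          have "\<bar>\<omega> \<bullet> (y - x)\<bar> \<le> norm \<omega> * norm (y - x)" by (rule Cauchy_Schwarz_ineq2)
          also have "\<dots> \<le> norm \<omega> * (D * r)"
            using y by (intro mult_left_mono) (auto simp: dist_norm norm_minus_commute)
          finally have th: "\<bar>\<omega> \<bullet> (y - x)\<bar> \<le> norm \<omega> * D * r" by simp
          have "iexp (\<omega> \<bullet> y) = iexp (\<omega> \<bullet> x) * iexp (\<omega> \<bullet> (y - x))"
            by (simp add: inner_diff_right flip: exp_add) (simp add: algebra_simps)
          then have "iexp (\<omega> \<bullet> y) * kfourier cs \<omega> - G (\<lambda>\<omega>. exp_taylor m (\<omega> \<bullet> (y - x))) \<omega> =
             iexp (\<omega> \<bullet> x) * kfourier cs \<omega> * (iexp (\<omega> \<bullet> (y - x)) - exp_taylor m (\<omega> \<bullet> (y - x)))"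
            using True by (simp add: G_def I_def indicator_def algebra_simps)
          then have "cmod (iexp (\<omega> \<bullet> y) * kfourier cs \<omega> - G (\<lambda>\<omega>. exp_taylor m (\<omega> \<bullet> (y - x))) \<omega>)
             = cmod (kfourier cs \<omega>) * cmod (iexp (\<omega> \<bullet> (y - x)) - exp_taylor m (\<omega> \<bullet> (y - x)))"
            by (simp add: norm_mult)
          also have "\<dots> \<le> cmod (kfourier cs \<omega>) * H \<omega>"
          proof (rule mult_left_mono)
            have "cmod (iexp (\<omega> \<bullet> (y - x)) - exp_taylor m (\<omega> \<bullet> (y - x))) \<le> \<bar>\<omega> \<bullet> (y - x)\<bar> ^ Suc m / fact (Suc m)"
              unfolding exp_taylor_def by (rule iexp_approx1)
            also have "\<dots> \<le> \<bar>\<omega> \<bullet> (y - x)\<bar> ^ Suc m / 1"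
              by (intro divide_left_mono) (auto simp del: fact_Suc intro: fact_ge_1)
            also have "\<dots> \<le> H \<omega>" using True th by (auto simp: H_def simp del: power_Suc intro!: power_mono)
            finally show "cmod (iexp (\<omega> \<bullet> (y - x)) - exp_taylor m (\<omega> \<bullet> (y - x))) \<le> H \<omega>" .
          qed simp
          finally show ?thesis .
        next
          case False
          then show ?thesis by (simp add: G_def I_def indicator_def H_def norm_mult)
        qed
        then have "norm (f\<Psi> \<omega> *\<^sub>R (iexp (\<omega> \<bullet> y) * kfourier cs \<omega>) - f\<Psi> \<omega> *\<^sub>R G (\<lambda>\<omega>. exp_taylor m (\<omega> \<bullet> (y - x))) \<omega>)
           \<le> f\<Psi> \<omega> * (cmod (kfourier cs \<omega>) * H \<omega>)"
          unfolding scaleR_diff_right[symmetric] norm_scaleR by (simp add: mult_left_mono)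
        \<comment> \<open>Young's inequality with weight \<open>s\<close>, chosen so that both
          resulting integrals are of order \<open>s\<close>.\<close>
        also have "\<dots> \<le> f\<Psi> \<omega> * ((s * (cmod (kfourier cs \<omega>))\<^sup>2 + (H \<omega>)\<^sup>2 / s) / 2)"
        proof (rule mult_left_mono)
          have "0 \<le> (s * cmod (kfourier cs \<omega>) - H \<omega>)\<^sup>2 / s" using s by simp
          also have "\<dots> = s * (cmod (kfourier cs \<omega>))\<^sup>2 + (H \<omega>)\<^sup>2 / s - 2 * (cmod (kfourier cs \<omega>) * H \<omega>)"
            using s by (simp add: power2_eq_square field_simps)
          finally show "cmod (kfourier cs \<omega>) * H \<omega> \<le> (s * (cmod (kfourier cs \<omega>))\<^sup>2 + (H \<omega>)\<^sup>2 / s) / 2" by simp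
        qed simp
        also have "\<dots> = (s * (f\<Psi> \<omega> * (cmod (kfourier cs \<omega>))\<^sup>2) + (f\<Psi> \<omega> * (H \<omega>)\<^sup>2) / s) / 2"
          by (simp add: algebra_simps add_divide_distrib)
        also have "\<dots> \<le> (s * (f\<Psi> \<omega> * (cmod (kfourier cs \<omega>))\<^sup>2) + (K * r powr (2 * \<nu>) * f\<Psi> (r *\<^sub>R \<omega>)) / s) / 2"
          using s by (intro divide_right_mono add_left_mono fH) auto
        finally show "norm (f\<Psi> \<omega> *\<^sub>R (iexp (\<omega> \<bullet> y) * kfourier cs \<omega>) - f\<Psi> \<omega> *\<^sub>R G (\<lambda>\<omega>. exp_taylor m (\<omega> \<bullet> (y - x))) \<omega>)
           \<le> (s * (f\<Psi> \<omega> * (cmod (kfourier cs \<omega>))\<^sup>2) + K * r powr (2 * \<nu>) / s * f\<Psi> (r *\<^sub>R \<omega>)) / 2"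
          by simp
      qed (use i1 i2 in auto)
      also have "\<dots> = (s * knorm2 \<Psi> cs + K * r powr (2 * \<nu>) / s * (1 / r ^ DIM('a))) / 2"
        using int1 integrable_lborel_scale[OF density_integrable r(1)]
        by (subst integral_divide_zero, subst Bochner_Integration.integral_add)
           (auto simp: knorm2_fourier integral_density kernel_0)
      also have "K * r powr (2 * \<nu>) / s * (1 / r ^ DIM('a)) = K * s"
      proof -
        have "r powr (2 * \<nu>) / s * (1 / r ^ DIM('a)) = s"
          unfolding s_def using r by (simp add: powr_diff powr_realpow[symmetric] powr_add[symmetric] field_simps)
        then show ?thesis by (metis times_divide_eq_right mult.assoc)
      qed
      also have "(s * knorm2 \<Psi> cs + K * s) / 2 \<le> (knorm2 \<Psi> cs + K) * s"
        using s K knorm2_nonneg[of cs] by (simp add: algebra_simps)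
      finally show ?thesis .
    qed
    have "cmod (complex_of_real (kcomb \<Psi> cs y)) \<le> B" for y
    proof -
      have "cmod (complex_of_real (kcomb \<Psi> cs y)) \<le> (LINT \<omega>|lborel. B * f\<Psi> \<omega>)"
        unfolding kcomb_fourier
      proof (rule Bochner_Integration.integral_norm_bound_integral)
        show "integrable lborel (\<lambda>\<omega>. f\<Psi> \<omega> *\<^sub>R (iexp (\<omega> \<bullet> y) * kfourier cs \<omega>))"
          using B by (intro integrable_density_bounded[where B=B]) (auto simp: norm_mult)
      qed (use B in \<open>auto simp: norm_mult mult.commute[of B] intro!: mult_left_mono\<close>)
      then show ?thesis by (simp add: integral_density kernel_0)
    qed
    then have "cmod (q y) \<le> B + (knorm2 \<Psi> cs + K) * s" if "y \<in> cball x (D * r)" for y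
      using near[OF that] norm_triangle_sub[of "q y" "complex_of_real (kcomb \<Psi> cs y)"]
      by (smt (verit) norm_minus_commute)
    then have "bounded (q ` cball x (D * r))" unfolding bounded_iff by blast
    with lp near show "\<exists>q :: 'a \<Rightarrow> complex. line_poly m q \<and> bounded (q ` cball x (D * r)) \<and>
      (\<forall>y\<in>cball x (D * r). cmod (complex_of_real (kcomb \<Psi> cs y) - q y)
        \<le> (knorm2 \<Psi> cs + K) * r powr (\<nu> - real DIM('a) / 2))"
      unfolding s_def by blast
  qed
qed

end

section \<open>Kernel ridge regression\<close>

text \<open>Gaussian elimination of the last unknown. The reduced matrix is again symmetric and
  positive definite, since its quadratic form is that of \<open>A\<close> minimised over the last
  coordinate.\<close>

lemma spd_system_solvable:
  fixes A :: "nat \<Rightarrow> nat \<Rightarrow> real"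
  assumes "\<And>j k. A j k = A k j"
    and "\<And>c. \<exists>j<n. c j \<noteq> 0 \<Longrightarrow> (\<Sum>j<n. \<Sum>k<n. c j * c k * A j k) > 0"
  shows "\<exists>c. \<forall>j<n. (\<Sum>k<n. A j k * c k) = y j"
  using assms
proof (induction n arbitrary: A y)
  case (Suc n)
  note sym = Suc.prems(1) and pd = Suc.prems(2)
  define a where "a = A n n"
  have "(\<Sum>j<Suc n. \<Sum>k<Suc n. (if j = n then 1 else 0) * (if k = n then 1 else 0) * A j k) > 0"
    by (rule pd) auto
  also have "(\<Sum>j<Suc n. \<Sum>k<Suc n. (if j = n then 1 else 0) * (if k = n then 1 else 0) * A j k) = a"
    by (simp add: a_def)
  finally have a: "a > 0" .
  \<comment> \<open>Schur complement of the last pivot\<close>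
  define A' where "A' j k = A j k - A j n * A n k / a" for j k
  have "\<exists>c. \<forall>j<n. (\<Sum>k<n. A' j k * c k) = y j - A j n * y n / a"
  proof (rule Suc.IH)
    show "A' j k = A' k j" for j k using sym by (simp add: A'_def mult.commute)
    fix c :: "nat \<Rightarrow> real" assume c: "\<exists>j<n. c j \<noteq> 0"
    define b where "b = (\<Sum>k<n. A n k * c k)"
    \<comment> \<open>The last coordinate that minimises the form for the given first
      \<open>n\<close> ones; inserting it completes the square.\<close>
    define c' where "c' k = (if k = n then - b / a else c k)" for k
    have "0 < (\<Sum>j<Suc n. \<Sum>k<Suc n. c' j * c' k * A j k)"
      using c by (intro pd) (auto simp: c'_def)
    also have "\<dots> = (\<Sum>j<n. (\<Sum>k<n. c j * c k * A j k) + c j * (- b / a) * A j n)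
        + ((\<Sum>k<n. (- b / a) * c k * A n k) + (- b / a) * (- b / a) * a)"
      by (simp add: c'_def a_def)
    also have "(\<Sum>k<n. (- b / a) * c k * A n k) = (- b / a) * b"
    proof -
      have "(\<Sum>k<n. (- b / a) * c k * A n k) = (- b / a) * (\<Sum>k<n. A n k * c k)"
        by (simp add: sum_distrib_left mult_ac)
      then show ?thesis by (simp only: b_def)
    qed
    also have "(\<Sum>j<n. (\<Sum>k<n. c j * c k * A j k) + c j * (- b / a) * A j n)
        = (\<Sum>j<n. (\<Sum>k<n. c j * c k * A j k)) + (- b / a) * b"
    proof -
      have "(\<Sum>j<n. c j * (- b / a) * A j n) = (- b / a) * (\<Sum>j<n. c j * A j n)"
        by (simp add: sum_distrib_left mult_ac)
      also have "(\<Sum>j<n. c j * A j n) = b"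
        unfolding b_def by (intro sum.cong refl) (metis sym mult.commute)
      finally show ?thesis by (simp only: sum.distrib)
    qed
    also have "(\<Sum>j<n. \<Sum>k<n. c j * c k * A j k) + (- b / a) * b + ((- b / a) * b + (- b / a) * (- b / a) * a)
       = (\<Sum>j<n. \<Sum>k<n. c j * c k * A j k) - b * b / a"
      using a by (simp add: field_simps)
    also have "b * b / a = (\<Sum>j<n. \<Sum>k<n. c j * c k * (A j n * A n k / a))"
      unfolding b_def sum_product sum_divide_distrib
      by (intro sum.cong refl) (simp add: sym[of n] mult_ac)
    finally show "0 < (\<Sum>j<n. \<Sum>k<n. c j * c k * A' j k)"
      by (simp add: A'_def right_diff_distrib sum_subtractf)
  qed
  then obtain c where c: "\<And>j. j < n \<Longrightarrow> (\<Sum>k<n. A' j k * c k) = y j - A j n * y n / a" by blast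
  define b where "b = (\<Sum>k<n. A n k * c k)"
  \<comment> \<open>Back substitution: the last equation is solved for its pivot unknown.\<close>
  define c' where "c' k = (if k = n then (y n - b) / a else c k)" for k
  have "(\<Sum>k<Suc n. A j k * c' k) = y j" if j: "j < Suc n" for j
  proof (cases "j = n")
    case True
    then show ?thesis using a by (simp add: c'_def b_def a_def)
  next
    case False
    have "(\<Sum>k<n. A' j k * c k) = (\<Sum>k<n. A j k * c k - A j n / a * (A n k * c k))"
      by (intro sum.cong refl) (simp add: A'_def left_diff_distrib)
    also have "\<dots> = (\<Sum>k<n. A j k * c k) - A j n / a * b"
      unfolding b_def by (simp only: sum_subtractf sum_distrib_left)
    finally have "(\<Sum>k<n. A j k * c k) - A j n / a * b = y j - A j n * y n / a"
      using c[of j] False j by simp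
    then show ?thesis using a by (simp add: c'_def field_simps)
  qed
  then show ?case by blast
qed simp

definition sample_comb :: "nat \<Rightarrow> (nat \<Rightarrow> 'a) \<Rightarrow> (nat \<Rightarrow> real) \<Rightarrow> (real \<times> 'a) list" where
  "sample_comb n X c = map (\<lambda>j. (c j, X j)) [0..<n]"

lemma sum_list_sample_comb:
  "(\<Sum>(a,z)\<leftarrow>sample_comb n X c. g a z) = (\<Sum>j<n. (g (c j) (X j) :: real))"
  by (simp add: sample_comb_def interv_sum_list_conv_sum_set_nat o_def lessThan_atLeast0)

context spectral_kernel
begin

lemma kernel_form_nonneg: "(\<Sum>j<(n::nat). \<Sum>k<n. c j * c k * \<Psi> (X j - X k)) \<ge> 0"
proof -
  have "knorm2 \<Psi> (sample_comb n X c) = (\<Sum>j<n. \<Sum>k<n. c j * c k * \<Psi> (X j - X k))"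
    unfolding knorm2_def sum_list_sample_comb ..
  then show ?thesis using knorm2_nonneg[of "sample_comb n X c"] by simp
qed

text \<open>Justifies the definite description. Adding \<open>\<mu>\<close> on the diagonal turns
  the semidefinite kernel form into a positive definite one, also for coinciding sample points; this
  gives a solution and its uniqueness on indices below \<open>n\<close>, and the convention of zeros
  from \<open>n\<close> on fixes it as a function.\<close>

lemma krr_coef:
  assumes \<mu>: "\<mu> > 0"
  shows "j < n \<Longrightarrow> (\<Sum>k<n. \<Psi> (X j - X k) * krr_coef \<Psi> \<mu> n X Y k) + \<mu> * krr_coef \<Psi> \<mu> n X Y j = Y j"
proof -
  define A where "A j k = \<Psi> (X j - X k) + (if j = k then \<mu> else 0)" for j k
  have row: "(\<Sum>k<n. A j k * c k) = (\<Sum>k<n. \<Psi> (X j - X k) * c k) + \<mu> * c j" if "j < n" for c j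
    using that by (simp add: A_def distrib_right sum.distrib if_distrib[of "\<lambda>x. x * _"] cong: if_cong)
  have pd: "(\<Sum>j<n. \<Sum>k<n. c j * c k * A j k) > 0" if c: "\<exists>j<n. c j \<noteq> 0" for c
  proof -
    have "(\<Sum>j<n. \<Sum>k<n. c j * c k * A j k) = (\<Sum>j<n. c j * (\<Sum>k<n. A j k * c k))"
      by (simp add: sum_distrib_left mult_ac)
    also have "\<dots> = (\<Sum>j<n. c j * ((\<Sum>k<n. \<Psi> (X j - X k) * c k) + \<mu> * c j))"
      by (intro sum.cong) (auto simp: row)
    also have "\<dots> = (\<Sum>j<n. \<Sum>k<n. c j * c k * \<Psi> (X j - X k)) + \<mu> * (\<Sum>j<n. c j * c j)"
      by (simp add: sum_distrib_left distrib_left sum.distrib mult_ac)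
    finally have eq: "(\<Sum>j<n. \<Sum>k<n. c j * c k * A j k) =
      (\<Sum>j<n. \<Sum>k<n. c j * c k * \<Psi> (X j - X k)) + \<mu> * (\<Sum>j<n. c j * c j)" .
    obtain i where "i < n" "c i \<noteq> 0" using c by blast
    then have "0 < (\<Sum>j<n. c j * c j)"
      by (intro sum_pos2[of _ i]) (auto simp: zero_less_mult_iff linorder_neq_iff)
    with \<mu> have "0 < \<mu> * (\<Sum>j<n. c j * c j)" by simp
    with kernel_form_nonneg[of c X n] show ?thesis unfolding eq by linarith
  qed
  have "\<exists>c. \<forall>j<n. (\<Sum>k<n. A j k * c k) = Y j"
    using pd by (intro spd_system_solvable) (auto simp: A_def kernel_commute)
  then obtain c where c: "\<And>j. j < n \<Longrightarrow> (\<Sum>k<n. A j k * c k) = Y j" by blast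
  let ?P = "\<lambda>c. (\<forall>k\<ge>n. c k = 0) \<and> (\<forall>j<n. (\<Sum>k<n. \<Psi> (X j - X k) * c k) + \<mu> * c j = Y j)"
  have "\<exists>!c. ?P c"
  proof (rule ex1I)
    show "?P (\<lambda>k. if k < n then c k else 0)"
      using c by (auto simp flip: row)
    fix b assume b: "?P b"
    \<comment> \<open>The difference of two solutions is annihilated by the matrix, so its quadratic
      form is 0, against positive definiteness.\<close>
    define g where "g k = b k - (if k < n then c k else 0)" for k
    have "\<not> (\<exists>j<n. g j \<noteq> 0)"
    proof
      assume "\<exists>j<n. g j \<noteq> 0"
      then have "0 < (\<Sum>j<n. \<Sum>k<n. g j * g k * A j k)" by (rule pd)
      also have "\<dots> = (\<Sum>j<n. g j * ((\<Sum>k<n. A j k * b k) - (\<Sum>k<n. A j k * c k)))"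
        by (simp add: g_def sum_distrib_left mult_ac right_diff_distrib left_diff_distrib sum_subtractf)
      also have "\<dots> = 0" using b c by (auto intro!: sum.neutral simp: row)
      finally show False by simp
    qed
    then have "b k = (if k < n then c k else 0)" for k
      using b by (cases "k < n") (auto simp: g_def)
    then show "b = (\<lambda>k. if k < n then c k else 0)" by blast
  qed
  from theI'[OF this] show "j < n \<Longrightarrow> (\<Sum>k<n. \<Psi> (X j - X k) * krr_coef \<Psi> \<mu> n X Y k) + \<mu> * krr_coef \<Psi> \<mu> n X Y j = Y j"
    unfolding krr_coef_def by blast
qed

lemma kcomb_krr:
  "kcomb \<Psi> (sample_comb n X (krr_coef \<Psi> \<mu> n X (\<lambda>k. f (X k)))) x = krr_est \<Psi> \<mu> n X f x"
  unfolding kcomb_def sum_list_sample_comb krr_est_def by (simp add: mult.commute)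

text \<open>The \<open>j\<close>-th normal equation, rearranged: at the sample points the error is
  the coefficient vector times \<open>\<mu>\<close>.\<close>

lemma krr_residual:
  assumes "\<mu> > 0" "j < n"
  shows "f (X j) - krr_est \<Psi> \<mu> n X f (X j) = \<mu> * krr_coef \<Psi> \<mu> n X (\<lambda>k. f (X k)) j"
  using krr_coef[OF assms, of X "\<lambda>k. f (X k)"] unfolding krr_est_def by simp

text \<open>\<open>S\<close> stands in for \<open>f\<close>; for \<open>S = f\<close> on the sample
  the last sum vanishes. By the normal equations the squared norm of the estimator is the pairing of
  \<open>c\<close> with the data minus \<open>\<mu>\<close> times the sum of squares. Substituting
  this twice leaves one nonnegative norm to discard.\<close>

lemma krr_energy:
  fixes f :: "'a \<Rightarrow> real" and X :: "nat \<Rightarrow> 'a" and n :: nat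
  assumes \<mu>: "\<mu> > 0"
  defines "c \<equiv> krr_coef \<Psi> \<mu> n X (\<lambda>k. f (X k))"
  shows "knorm2 \<Psi> (S @ kneg (sample_comb n X c)) + 2 * \<mu> * (\<Sum>j<n. (c j)\<^sup>2)
     \<le> knorm2 \<Psi> S + 2 * (\<Sum>j<n. c j * (f (X j) - kcomb \<Psi> S (X j)))"
proof -
  have "knorm2 \<Psi> (sample_comb n X c) = (\<Sum>j<n. c j * krr_est \<Psi> \<mu> n X f (X j))"
    unfolding knorm2_eq_kcomb sum_list_sample_comb c_def kcomb_krr ..
  also have "\<dots> = (\<Sum>j<n. c j * (f (X j) - \<mu> * c j))"
    by (intro sum.cong refl) (use krr_residual[OF \<mu>, of _ n f X] in \<open>auto simp: c_def algebra_simps\<close>)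
  also have "\<dots> = (\<Sum>j<n. c j * f (X j)) - \<mu> * (\<Sum>j<n. (c j)\<^sup>2)"
    by (simp add: right_diff_distrib sum_subtractf sum_distrib_left power2_eq_square mult_ac)
  finally have F: "knorm2 \<Psi> (sample_comb n X c) = (\<Sum>j<n. c j * f (X j)) - \<mu> * (\<Sum>j<n. (c j)\<^sup>2)" .
  have "knorm2 \<Psi> (S @ kneg (sample_comb n X c)) =
     knorm2 \<Psi> S - 2 * (\<Sum>j<n. c j * kcomb \<Psi> S (X j)) + knorm2 \<Psi> (sample_comb n X c)"
    unfolding knorm2_diff sum_list_sample_comb ..
  with F knorm2_nonneg[of "sample_comb n X c"] show ?thesis
    by (simp add: right_diff_distrib sum_subtractf)
qed

text \<open>The error is only a limit of finite combinations. The list \<open>es\<close> is a late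
  member of the approximating sequence minus the estimator, accurate to \<open>\<delta>\<close> at
  the finitely many points in question. How late may depend on all data; \<open>B\<close> depends on
  the sequence for \<open>f\<close> alone.\<close>

lemma krr_error_approx:
  assumes f: "f \<in> native_space \<Psi> \<Omega>"
  shows "\<exists>B\<ge>0. \<forall>n \<mu> X x \<delta>. \<mu> > 0 \<longrightarrow> \<delta> > 0 \<longrightarrow> (\<forall>j<n. X j \<in> \<Omega>) \<longrightarrow> x \<in> \<Omega> \<longrightarrow>
     (\<Sum>j<n. (f (X j) - krr_est \<Psi> \<mu> n X f (X j))\<^sup>2) \<le> \<mu> * B \<and>
     (\<exists>es. knorm2 \<Psi> es \<le> B \<and>
        (\<forall>y\<in>insert x (X ` {..<n}). \<bar>kcomb \<Psi> es y - (f y - krr_est \<Psi> \<mu> n X f y)\<bar> < \<delta>))"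
proof -
  from f obtain S :: "nat \<Rightarrow> (real \<times> 'a) list"
    where lim: "\<And>x. x \<in> \<Omega> \<Longrightarrow> (\<lambda>m. kcomb \<Psi> (S m) x) \<longlonglongrightarrow> f x"
      and cau: "\<And>e. e > 0 \<Longrightarrow> \<exists>N. \<forall>m\<ge>N. \<forall>k\<ge>N. knorm2 \<Psi> (S m @ kneg (S k)) < e"
    unfolding native_space_def by blast
  obtain N where N: "\<And>m k. m \<ge> N \<Longrightarrow> k \<ge> N \<Longrightarrow> knorm2 \<Psi> (S m @ kneg (S k)) < 1"
    using cau[of 1] by auto
  \<comment> \<open>By \<open>knorm2_le_double\<close> the late members have squared norm at most
    \<open>2 + 2 * knorm2 \<Psi> (S N)\<close>; the remaining 1 pays for the mismatch term in
    \<open>krr_energy\<close>.\<close>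
  define B where "B = 3 + 2 * knorm2 \<Psi> (S N)"
  have B0: "B \<ge> 0" using knorm2_nonneg[of "S N"] by (simp add: B_def)
  have SB: "knorm2 \<Psi> (S m) \<le> B - 1" if "m \<ge> N" for m
    using knorm2_le_double[of "S m" "S N"] N[of m N] that by (simp add: B_def)
  show ?thesis
  proof (intro exI[of _ B] conjI allI impI B0)
    fix n and \<mu> :: real and X :: "nat \<Rightarrow> 'a" and x :: 'a and \<delta> :: real
    assume \<mu>: "\<mu> > 0" and d: "\<delta> > 0" and X: "\<forall>j<n. X j \<in> \<Omega>" and x: "x \<in> \<Omega>"
    define c where "c = krr_coef \<Psi> \<mu> n X (\<lambda>k. f (X k))"
    \<comment> \<open>The coefficients do not depend on \<open>m\<close>, so pointwise convergence
      at the \<open>n\<close> sample points makes the mismatch term tend to 0.\<close>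
    have "(\<lambda>m. 2 * (\<Sum>j<n. c j * (f (X j) - kcomb \<Psi> (S m) (X j)))) \<longlonglongrightarrow> 2 * (\<Sum>j<n. c j * (f (X j) - f (X j)))"
      using X by (intro tendsto_intros lim) auto
    then have "\<forall>\<^sub>F m in sequentially. 2 * (\<Sum>j<n. c j * (f (X j) - kcomb \<Psi> (S m) (X j))) < 1"
      by (rule order_tendstoD(2)) simp
    moreover have "\<forall>\<^sub>F m in sequentially. \<forall>y\<in>insert x (X ` {..<n}). \<bar>kcomb \<Psi> (S m) y - f y\<bar> < \<delta>"
      using X x lim d by (intro eventually_ball_finite) (auto simp: tendsto_iff dist_real_def)
    moreover have "\<forall>\<^sub>F m in sequentially. m \<ge> N" by (rule eventually_ge_at_top)
    ultimately have "\<forall>\<^sub>F m in sequentially. 2 * (\<Sum>j<n. c j * (f (X j) - kcomb \<Psi> (S m) (X j))) < 1 \<and>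
        (\<forall>y\<in>insert x (X ` {..<n}). \<bar>kcomb \<Psi> (S m) y - f y\<bar> < \<delta>) \<and> m \<ge> N"
      by eventually_elim auto
    then obtain m where m: "2 * (\<Sum>j<n. c j * (f (X j) - kcomb \<Psi> (S m) (X j))) < 1"
        "\<forall>y\<in>insert x (X ` {..<n}). \<bar>kcomb \<Psi> (S m) y - f y\<bar> < \<delta>" "m \<ge> N"
      using eventually_happens'[OF sequentially_bot] by blast
    define es where "es = S m @ kneg (sample_comb n X c)"
    have en: "knorm2 \<Psi> es + 2 * \<mu> * (\<Sum>j<n. (c j)\<^sup>2) \<le> B"
      using krr_energy[OF \<mu>, of "S m" n X f] m(1) SB[OF m(3)] unfolding es_def c_def by linarith
    have c0: "0 \<le> 2 * \<mu> * (\<Sum>j<n. (c j)\<^sup>2)" using \<mu> by (auto intro!: mult_nonneg_nonneg sum_nonneg)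
    have "(\<Sum>j<n. (f (X j) - krr_est \<Psi> \<mu> n X f (X j))\<^sup>2) = (\<Sum>j<n. \<mu>\<^sup>2 * (c j)\<^sup>2)"
      using krr_residual[OF \<mu>, of _ n f X] by (intro sum.cong) (auto simp: c_def power_mult_distrib)
    also have "\<dots> = \<mu> * (\<mu> * (\<Sum>j<n. (c j)\<^sup>2))" by (simp add: power2_eq_square sum_distrib_left mult.assoc)
    also have "\<dots> \<le> \<mu> * B"
      using en c0 knorm2_nonneg[of es] \<mu> by (intro mult_left_mono) auto
    finally show "(\<Sum>j<n. (f (X j) - krr_est \<Psi> \<mu> n X f (X j))\<^sup>2) \<le> \<mu> * B" .
    have "kcomb \<Psi> es y - (f y - krr_est \<Psi> \<mu> n X f y) = kcomb \<Psi> (S m) y - f y" for y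
      by (simp add: es_def c_def kcomb_krr)
    then have "\<forall>y\<in>insert x (X ` {..<n}). \<bar>kcomb \<Psi> es y - (f y - krr_est \<Psi> \<mu> n X f y)\<bar> < \<delta>"
      using m(2) by (simp only:)
    with en c0 show "\<exists>es. knorm2 \<Psi> es \<le> B \<and>
        (\<forall>y\<in>insert x (X ` {..<n}). \<bar>kcomb \<Psi> es y - (f y - krr_est \<Psi> \<mu> n X f y)\<bar> < \<delta>)"
      by (intro exI[of _ es] conjI) simp_all
  qed
qed

end

section \<open>Uniformly distributed samples\<close>

text \<open>The cubic lattice of mesh \<open>l\<close>: rounding every coordinate down moves it by
  at most \<open>l\<close>, and the Euclidean norm is bounded by the sum of the coordinates, whence
  the factor \<open>DIM('a)\<close>.\<close>

lemma lattice_net: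
  fixes l D :: real
  assumes l: "l > 0" and D: "D \<ge> 0"
  shows "\<exists>Z :: 'a::euclidean_space set. finite Z \<and> real (card Z) \<le> (2 * D / l + 3) ^ DIM('a) \<and>
     (\<forall>u. norm u \<le> D \<longrightarrow> (\<exists>z\<in>Z. norm (u - z) \<le> real DIM('a) * l))"
proof -
  define K where "K = \<lceil>D / l\<rceil>"
  have "0 \<le> D / l" using l D by simp
  then have K: "K \<ge> 0" unfolding K_def by linarith
  define P where "P = PiE (Basis :: 'a set) (\<lambda>_. {- K..K})"
  define h :: "('a \<Rightarrow> int) \<Rightarrow> 'a" where "h k = (\<Sum>b\<in>Basis. (of_int (k b) * l) *\<^sub>R b)" for k
  have fin: "finite P" by (auto simp: P_def intro!: finite_PiE)
  have "card (h ` P) \<le> card P" using fin by (rule card_image_le)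
  also have "card P = nat (2 * K + 1) ^ DIM('a)"
    unfolding P_def by (subst card_PiE) auto
  finally have "real (card (h ` P)) \<le> real (nat (2 * K + 1)) ^ DIM('a)"
    by (metis of_nat_le_iff of_nat_power)
  also have "\<dots> \<le> (2 * D / l + 3) ^ DIM('a)"
  proof (rule power_mono)
    have "real_of_int K \<le> D / l + 1" unfolding K_def by linarith
    then show "real (nat (2 * K + 1)) \<le> 2 * D / l + 3" using K by simp
  qed simp
  finally have card: "real (card (h ` P)) \<le> (2 * D / l + 3) ^ DIM('a)" .
  have "\<exists>z\<in>h ` P. norm (u - z) \<le> real DIM('a) * l" if u: "norm u \<le> D" for u :: 'a
  proof -
    \<comment> \<open>The restriction makes the index vector extensional, as membership in
      \<open>PiE\<close> demands.\<close>
    define k where "k = restrict (\<lambda>b. \<lfloor>u \<bullet> b / l\<rfloor>) Basis"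
    have "- K \<le> \<lfloor>u \<bullet> b / l\<rfloor> \<and> \<lfloor>u \<bullet> b / l\<rfloor> \<le> K" if b: "b \<in> Basis" for b
    proof -
      have ub: "\<bar>u \<bullet> b\<bar> \<le> D" using Basis_le_norm[OF b, of u] u by simp
      then have "- (D / l) \<le> u \<bullet> b / l" "u \<bullet> b / l \<le> D / l"
        using l by (auto simp: field_simps)
      then show ?thesis unfolding K_def ceiling_def
        using floor_mono[of "- (D / l)" "u \<bullet> b / l"] floor_mono[of "u \<bullet> b / l" "D / l"]
          floor_le_ceiling[of "D / l"] by (auto simp: ceiling_def)
    qed
    then have kP: "k \<in> P" by (auto simp: k_def P_def)
    have "norm (u - h k) \<le> (\<Sum>b\<in>Basis. \<bar>(u - h k) \<bullet> b\<bar>)" by (rule norm_le_l1)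
    also have "\<dots> \<le> (\<Sum>b\<in>(Basis::'a set). l)"
    proof (rule sum_mono)
      fix b :: 'a assume b: "b \<in> Basis"
      have "h k \<bullet> b = of_int \<lfloor>u \<bullet> b / l\<rfloor> * l"
        using b by (simp add: h_def k_def inner_sum_left inner_Basis if_distrib sum.delta cong: if_cong)
      moreover have "of_int \<lfloor>u \<bullet> b / l\<rfloor> * l \<le> u \<bullet> b" "u \<bullet> b \<le> of_int \<lfloor>u \<bullet> b / l\<rfloor> * l + l"
        using floor_divide_lower[OF l, of "u \<bullet> b"] floor_divide_upper[OF l, of "u \<bullet> b"]
        by (auto simp: algebra_simps)
      ultimately show "\<bar>(u - h k) \<bullet> b\<bar> \<le> l" by (simp add: inner_diff_left)
    qed
    finally show ?thesis using kP by auto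
  qed
  with fin card show ?thesis by (intro exI[of _ "h ` P"]) auto
qed

text \<open>Chernoff's lower tail: the multiplicative form is needed, because the cells have
  vanishing probability.\<close>
lemma count_lower_tail:
  fixes U :: "'b measure" and n :: nat
  assumes U: "prob_space U" and T: "T \<in> sets U"
  defines "M \<equiv> PiM {..<n} (\<lambda>_. U)"
  shows "measure M {X \<in> space M. (\<Sum>j<n. indicator T (X j)) < real n * measure U T / 4}
     \<le> exp (- (real n * measure U T / 4))"
proof -
  interpret U: prob_space U by fact
  interpret P: product_prob_space "\<lambda>_::nat. U" "{..<n}" by unfold_locales
  have PM: "prob_space M" unfolding M_def by (intro prob_space_PiM U)
  interpret M: prob_space M by (rule PM)
  note T[measurable]
  define q where "q = measure U T"
  define t where "t = real n * q / 4"
  \<comment> \<open>Exponential moment with parameter 1: its mean is at most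
    \<open>exp (- (q / 2))\<close>, so by independence the product over the sample has mean at most
    \<open>exp (- 2 * t)\<close>. Markov's inequality costs a factor \<open>exp t\<close>, leaving
    \<open>exp (- t)\<close>.\<close>
  define g where "g y = exp (- indicator T y :: real)" for y
  have g: "g y = 1 - (1 - exp (-1)) * indicator T y" for y by (simp add: g_def indicator_def)
  have [measurable]: "g \<in> borel_measurable U" unfolding g_def by measurable
  have "(LINT y|U. g y) = 1 - (1 - exp (-1)) * q"
    unfolding g q_def by (subst Bochner_Integration.integral_diff) (auto simp: U.prob_space less_top[symmetric])
  also have "\<dots> \<le> 1 + (- (q / 2))"
  proof -
    have "(2::real) \<le> exp 1" using exp_ge_add_one_self[of 1] by simp
    then have "exp (-1) \<le> (1/2 :: real)" by (simp add: exp_minus field_simps)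
    then have "1/2 * q \<le> (1 - exp (-1)) * q" unfolding q_def by (intro mult_right_mono) auto
    then show ?thesis by simp
  qed
  also have "\<dots> \<le> exp (- (q / 2))" by (rule exp_ge_add_one_self)
  finally have gi: "(LINT y|U. g y) \<le> exp (- (q / 2))" .
  have "(\<integral>\<^sup>+ y. ennreal (g y) \<partial>U) = ennreal (LINT y|U. g y)"
  proof (rule nn_integral_eq_integral)
    show "integrable U g"
      by (rule U.integrable_const_bound[where B=1]) (auto simp: g_def indicator_def)
  qed (simp add: g_def)
  with gi have gn: "(\<integral>\<^sup>+ y. ennreal (g y) \<partial>U) \<le> ennreal (exp (- (q / 2)))"
    by (simp add: ennreal_leI)
  have prodg: "(\<Prod>j<n. ennreal (g (X j))) = ennreal (exp (- (\<Sum>j<n. indicator T (X j))))" for X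
    by (subst prod_ennreal) (auto simp: g_def exp_sum sum_negf[symmetric])
  have [measurable]: "(\<lambda>X. (\<Sum>j<n. indicator T (X j)) :: real) \<in> borel_measurable M"
    unfolding M_def by measurable
  have "emeasure M {X \<in> space M. (\<Sum>j<n. indicator T (X j)) < t} \<le>
      emeasure M {X \<in> space M. 1 \<le> ennreal (exp t) * (\<Prod>j<n. ennreal (g (X j)))}"
  proof (rule emeasure_mono)
    show "{X \<in> space M. (\<Sum>j<n. indicator T (X j)) < t} \<subseteq>
        {X \<in> space M. 1 \<le> ennreal (exp t) * (\<Prod>j<n. ennreal (g (X j)))}"
      unfolding prodg by (auto simp: ennreal_mult[symmetric] exp_add[symmetric] ennreal_ge_1)
  qed (simp add: prodg)
  also have "\<dots> \<le> ennreal (exp t) * (\<integral>\<^sup>+ X. (\<Prod>j<n. ennreal (g (X j))) * indicator (space M) X \<partial>M)"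
    using nn_integral_Markov_inequality[of "\<lambda>X. \<Prod>j<n. ennreal (g (X j))" "space M" M "ennreal (exp t)"]
    by (simp add: prodg)
  also have "(\<integral>\<^sup>+ X. (\<Prod>j<n. ennreal (g (X j))) * indicator (space M) X \<partial>M) = (\<integral>\<^sup>+ X. (\<Prod>j<n. ennreal (g (X j))) \<partial>M)"
    by (intro nn_integral_cong) auto
  also have "\<dots> = (\<Prod>j<n. \<integral>\<^sup>+ y. ennreal (g y) \<partial>U)"
    unfolding M_def by (subst P.product_nn_integral_prod[of "{..<n}" "\<lambda>_ y. ennreal (g y)"]) auto
  also have "\<dots> \<le> (\<Prod>j<n. ennreal (exp (- (q / 2))))" by (intro prod_mono_ennreal gn)
  also have "\<dots> = ennreal (exp (- (real n * q / 2)))"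
    by (simp add: ennreal_power exp_of_nat_mult[symmetric])
  also have "ennreal (exp t) * \<dots> = ennreal (exp (- t))"
    by (simp add: ennreal_mult[symmetric] exp_add[symmetric] t_def)
  finally have "emeasure M {X \<in> space M. (\<Sum>j<n. indicator T (X j)) < t} \<le> ennreal (exp (- t))"
    by (simp add: mult_left_mono)
  then show ?thesis unfolding M.emeasure_eq_measure t_def q_def by simp
qed

text \<open>A union bound over a finite net suffices for all balls at once: a ball of radius
  \<open>(DIM('a) + 1) * l\<close> contains the ball of radius \<open>l\<close> around a net point
  near its centre. The number \<open>k\<close> is a quarter of the expected count in such a net
  ball.\<close>

lemma well_spread_event:
  fixes \<Omega> :: "'a::euclidean_space set" and l D :: real and n :: nat
  assumes cpt: "compact \<Omega>" and pos: "emeasure lborel \<Omega> > 0"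
    and l: "l > 0" and D: "\<Omega> \<subseteq> cball 0 D"
  defines "k \<equiv> real n * (unit_ball_vol DIM('a) / measure lborel \<Omega>) * l ^ DIM('a) / 4"
  shows "\<exists>A\<in>sets (sample_space \<Omega> n).
    measure (sample_space \<Omega> n) A \<ge> 1 - (2 * D / l + 3) ^ DIM('a) * exp (- k) \<and>
    (\<forall>X\<in>A. X \<in> space (sample_space \<Omega> n) \<and> (\<forall>j<n. X j \<in> \<Omega>) \<and>
      (\<forall>u. cball u ((real DIM('a) + 1) * l) \<subseteq> \<Omega> \<longrightarrow>
         k \<le> real (card {j\<in>{..<n}. norm (X j - u) \<le> (real DIM('a) + 1) * l})))"
proof -
  define U where "U = uniform_measure lborel \<Omega>"
  define M where "M = sample_space \<Omega> n"
  have Mdef: "M = PiM {..<n} (\<lambda>_. U)" by (simp add: M_def sample_space_def U_def)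
  have \<Omega>m[measurable]: "\<Omega> \<in> sets borel" using cpt by (simp add: borel_compact)
  have fin: "emeasure lborel \<Omega> < \<infinity>" using emeasure_compact_finite[OF cpt] by simp
  have Up: "prob_space U" unfolding U_def using pos fin by (intro prob_space_uniform_measure) auto
  have Us[measurable_cong, simp]: "sets U = sets borel" by (simp add: U_def)
  have PM: "prob_space M" unfolding Mdef by (intro prob_space_PiM Up)
  interpret M: prob_space M by (rule PM)
  have "\<Omega> \<noteq> {}" using pos by auto
  then have D0: "D \<ge> 0" using D by (metis cball_eq_empty not_less subset_empty)
  obtain Z :: "'a set" where Z: "finite Z" "real (card Z) \<le> (2 * D / l + 3) ^ DIM('a)"
    "\<And>u. norm u \<le> D \<Longrightarrow> \<exists>z\<in>Z. norm (u - z) \<le> real DIM('a) * l"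
    using lattice_net[OF l D0, where 'a='a] by blast
  \<comment> \<open>For net balls inside \<open>\<Omega>\<close> the probability is exactly the
    quotient of volumes.\<close>
  define Z' where "Z' = {z\<in>Z. cball z l \<subseteq> \<Omega>}"
  have Z': "finite Z'" using Z by (auto simp: Z'_def)
  define N where "N z X = (\<Sum>j<n. indicator (cball z l) (X j) :: real)" for z and X :: "nat \<Rightarrow> 'a"
  have [measurable]: "cball z l \<in> sets borel" for z :: 'a by simp
  have [measurable]: "N z \<in> borel_measurable M" for z unfolding N_def Mdef by measurable
  have tail: "measure M {X \<in> space M. N z X < k} \<le> exp (- k)" if z: "z \<in> Z'" for z
  proof -
    have "measure U (cball z l) = measure lborel (\<Omega> \<inter> cball z l) / measure lborel \<Omega>"
      unfolding U_def using pos fin by (intro measure_uniform_measure) auto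
    also have "\<Omega> \<inter> cball z l = cball z l" using z by (auto simp: Z'_def)
    also have "measure lborel (cball z l) = unit_ball_vol DIM('a) * l ^ DIM('a)"
      using l by (simp add: content_cball)
    finally have "real n * measure U (cball z l) / 4 = k" by (simp add: k_def)
    then show ?thesis
      using count_lower_tail[OF Up, of "cball z l" n] unfolding Mdef N_def by simp
  qed
  define A0 where "A0 = {X \<in> space M. \<forall>z\<in>Z'. k \<le> N z X}"
  define A where "A = {X \<in> space M. (\<forall>z\<in>Z'. k \<le> N z X) \<and> (\<forall>j<n. X j \<in> \<Omega>)}"
  have A0m[measurable]: "A0 \<in> sets M" unfolding A0_def using Z' by measurable
  have Am[measurable]: "A \<in> sets M" unfolding A_def using Z' by (measurable; simp add: Mdef)
  \<comment> \<open>The sample space ranges over the whole Euclidean space, so lying in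
    \<open>\<Omega>\<close> holds only almost surely; imposing it on the event changes no
    probability.\<close>
  have "AE X in M. \<forall>j\<in>{..<n}. X j \<in> \<Omega>"
  proof (rule AE_finite_allI)
    fix j assume "j \<in> {..<n}"
    moreover have "AE y in U. y \<in> \<Omega>" unfolding U_def by (intro AE_uniform_measureI) auto
    ultimately show "AE X in M. X j \<in> \<Omega>" unfolding Mdef by (intro AE_PiM_component Up)
  qed simp
  then have "measure M A = measure M A0"
    by (intro measure_eq_AE A0m Am) (auto simp: A_def A0_def)
  also have "\<dots> = 1 - measure M (\<Union>z\<in>Z'. {X \<in> space M. N z X < k})"
  proof -
    have "A0 = space M - (\<Union>z\<in>Z'. {X \<in> space M. N z X < k})" by (auto simp: A0_def not_less)
    moreover have "(\<Union>z\<in>Z'. {X \<in> space M. N z X < k}) \<in> sets M"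
      using Z' by (intro sets.finite_UN) measurable
    ultimately show ?thesis by (simp add: M.prob_compl)
  qed
  also have "\<dots> \<ge> 1 - (\<Sum>z\<in>Z'. measure M {X \<in> space M. N z X < k})"
    using Z' by (intro diff_left_mono M.finite_measure_subadditive_finite) auto
  also have "1 - (\<Sum>z\<in>Z'. measure M {X \<in> space M. N z X < k}) \<ge> 1 - (2 * D / l + 3) ^ DIM('a) * exp (- k)"
  proof -
    have "(\<Sum>z\<in>Z'. measure M {X \<in> space M. N z X < k}) \<le> (\<Sum>z\<in>Z'. exp (- k))"
      by (intro sum_mono tail)
    also have "\<dots> = real (card Z') * exp (- k)" by simp
    also have "\<dots> \<le> (2 * D / l + 3) ^ DIM('a) * exp (- k)"
    proof (rule mult_right_mono)
      have "card Z' \<le> card Z" using Z(1) by (intro card_mono) (auto simp: Z'_def)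
      then show "real (card Z') \<le> (2 * D / l + 3) ^ DIM('a)" using Z(2) by linarith
    qed simp
    finally show ?thesis by simp
  qed
  finally have prob: "measure M A \<ge> 1 - (2 * D / l + 3) ^ DIM('a) * exp (- k)" .
  have cnt: "k \<le> real (card {j\<in>{..<n}. norm (X j - u) \<le> (real DIM('a) + 1) * l})"
    if X: "X \<in> A" and u: "cball u ((real DIM('a) + 1) * l) \<subseteq> \<Omega>" for X u
  proof -
    have "u \<in> cball u ((real DIM('a) + 1) * l)" using l by auto
    then have "u \<in> cball 0 D" using u D by blast
    then have "norm u \<le> D" by simp
    then obtain z where z: "z \<in> Z" "norm (u - z) \<le> real DIM('a) * l" using Z(3) by blast
    have sub: "cball z l \<subseteq> cball u ((real DIM('a) + 1) * l)"
    proof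
      fix y assume "y \<in> cball z l"
      then have "dist u y \<le> real DIM('a) * l + l"
        using z(2) by (intro dist_triangle_le[of u z]) (auto simp: dist_norm norm_minus_commute[of y] intro: add_mono)
      then show "y \<in> cball u ((real DIM('a) + 1) * l)" by (simp add: algebra_simps)
    qed
    then have "z \<in> Z'" using u z by (auto simp: Z'_def)
    then have "k \<le> N z X" using X by (auto simp: A_def)
    also have "N z X = real (card {j\<in>{..<n}. X j \<in> cball z l})"
      by (simp add: N_def indicator_def sum.If_cases Int_def)
    also have "\<dots> \<le> real (card {j\<in>{..<n}. norm (X j - u) \<le> (real DIM('a) + 1) * l})"
    proof -
      have "{j\<in>{..<n}. X j \<in> cball z l} \<subseteq> {j\<in>{..<n}. norm (X j - u) \<le> (real DIM('a) + 1) * l}"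
      proof
        fix j assume j: "j \<in> {j\<in>{..<n}. X j \<in> cball z l}"
        then have "X j \<in> cball u ((real DIM('a) + 1) * l)" using sub by blast
        then show "j \<in> {j\<in>{..<n}. norm (X j - u) \<le> (real DIM('a) + 1) * l}"
          using j by (simp add: dist_norm norm_minus_commute)
      qed
      then show ?thesis by (intro of_nat_mono card_mono) auto
    qed
    finally show ?thesis .
  qed
  have "A \<in> sets (sample_space \<Omega> n)" using Am by (simp add: M_def)
  moreover have "X \<in> space (sample_space \<Omega> n)" "\<forall>j<n. X j \<in> \<Omega>" if "X \<in> A" for X
    using that by (auto simp: A_def M_def)
  ultimately show ?thesis using prob cnt unfolding M_def by (intro bexI[of _ A]) auto
qed

section \<open>The uniform error bound\<close>

lemma exists_le_average:
  fixes g :: "'b \<Rightarrow> real"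
  assumes "finite J" "J \<subseteq> I" "finite I" "\<And>i. i \<in> I \<Longrightarrow> g i \<ge> 0" "sum g I \<le> S" "0 < k" "k \<le> real (card J)" "S \<ge> 0"
  shows "\<exists>j\<in>J. g j \<le> S / k"
proof (rule ccontr)
  assume "\<not> (\<exists>j\<in>J. g j \<le> S / k)"
  then have "\<And>j. j \<in> J \<Longrightarrow> S / k < g j" by auto
  moreover have "J \<noteq> {}" using assms by auto
  ultimately have "(\<Sum>j\<in>J. S / k) < sum g J" using assms by (intro sum_strict_mono) auto
  also have "\<dots> \<le> sum g I" using assms by (intro sum_mono2) auto
  finally have "real (card J) * (S / k) < S" using assms by simp
  moreover have "k * (S / k) \<le> real (card J) * (S / k)" using assms by (intro mult_right_mono) auto
  ultimately show False using assms by simp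
qed

context sobolev_kernel
begin

text \<open>The deterministic half of the argument. The cell factor \<open>\<kappa>\<close> is fixed
  before \<open>T\<close>, because the value of \<open>T\<close> used later depends on the expected
  cell counts and hence on \<open>\<kappa>\<close>.\<close>

lemma krr_sup_bound:
  assumes conv: "convex \<Omega>" and c0: "cball c0 \<rho>0 \<subseteq> \<Omega>" and \<rho>0: "\<rho>0 > 0"
    and D: "D \<ge> 1" "\<And>x y. x \<in> \<Omega> \<Longrightarrow> y \<in> \<Omega> \<Longrightarrow> dist x y \<le> D" and f: "f \<in> native_space \<Psi> \<Omega>"
  shows "\<exists>\<kappa>>0. \<forall>T\<ge>0. \<exists>C>0. \<forall>n \<mu> X r k. \<mu> > 0 \<longrightarrow> 0 < r \<longrightarrow> r \<le> 1 \<longrightarrow> 0 < k \<longrightarrow> (\<forall>j<n. X j \<in> \<Omega>) \<longrightarrow>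
     (\<forall>u. cball u (\<kappa> * r) \<subseteq> \<Omega> \<longrightarrow> k \<le> real (card {j\<in>{..<n}. norm (X j - u) \<le> \<kappa> * r})) \<longrightarrow>
     \<mu> \<le> T * k * (r powr (\<nu> - real DIM('a) / 2))\<^sup>2 \<longrightarrow>
     (\<forall>x\<in>\<Omega>. \<bar>f x - krr_est \<Psi> \<mu> n X f x\<bar> \<le> C * r powr (\<nu> - real DIM('a) / 2))"
proof -
  have c0\<Omega>: "c0 \<in> \<Omega>" using c0 \<rho>0 by (meson centre_in_cball less_imp_le subsetD)
  define m where "m = nat \<lceil>\<nu>\<rceil>"
  have m: "\<nu> \<le> real (Suc m)" unfolding m_def using nu_pos by linarith
  obtain \<epsilon> where \<epsilon>: "\<epsilon> > 0" "\<epsilon> \<le> 1" and norming: "\<And>(q :: 'a \<Rightarrow> complex) c \<rho> s.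
     line_poly m q \<Longrightarrow> bounded (q ` cball c \<rho>) \<Longrightarrow> \<rho> > 0 \<Longrightarrow>
     (\<forall>u\<in>cball c \<rho>. \<exists>v\<in>cball c \<rho>. norm (u - v) \<le> \<epsilon> * \<rho> \<and> norm (q v) \<le> s) \<Longrightarrow>
     (\<forall>u\<in>cball c \<rho>. norm (q u) \<le> 2 * s)"
    using line_poly_norming[of m, where 'a='a and 'v=complex] by blast
  obtain E where E: "E \<ge> 1" and ext: "\<And>(q :: 'a \<Rightarrow> complex) c \<rho> M L y.
     line_poly m q \<Longrightarrow> L \<ge> 1 \<Longrightarrow> (\<forall>y\<in>cball c \<rho>. norm (q y) \<le> M) \<Longrightarrow>
     y \<in> cball c (L * \<rho>) \<Longrightarrow> norm (q y) \<le> E * L ^ m * M"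
    using line_poly_extrapolate[of m, where 'a='a and 'v=complex] by blast
  obtain C0 where C0: "C0 \<ge> 0" and loc: "\<And>cs r x. 0 < r \<Longrightarrow> r \<le> 1 \<Longrightarrow> (\<exists>q :: 'a \<Rightarrow> complex. line_poly m q \<and>
    bounded (q ` cball x (D * r)) \<and>
    (\<forall>y\<in>cball x (D * r). cmod (complex_of_real (kcomb \<Psi> cs y) - q y)
        \<le> (knorm2 \<Psi> cs + C0) * r powr (\<nu> - real DIM('a) / 2)))"
    using kcomb_local_poly[OF m D(1)] by blast
  obtain B where B: "B \<ge> 0" and appr: "\<And>n \<mu> X x \<delta>. \<mu> > 0 \<Longrightarrow> \<delta> > 0 \<Longrightarrow> (\<forall>j<n. X j \<in> \<Omega>) \<Longrightarrow> x \<in> \<Omega> \<Longrightarrow>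
     (\<Sum>j<n. (f (X j) - krr_est \<Psi> \<mu> n X f (X j))\<^sup>2) \<le> \<mu> * B \<and>
     (\<exists>es. knorm2 \<Psi> es \<le> B \<and>
        (\<forall>y\<in>insert x (X ` {..<n}). \<bar>kcomb \<Psi> es y - (f y - krr_est \<Psi> \<mu> n X f y)\<bar> < \<delta>))"
    using krr_error_approx[OF f] by blast
  \<comment> \<open>Half of the norming distance: one half is spent on moving into the interior of
    the ball, the other on reaching a sample point.\<close>
  define \<kappa> where "\<kappa> = \<epsilon> * \<rho>0 / 2"
  have \<kappa>: "\<kappa> > 0" using \<epsilon> \<rho>0 by (simp add: \<kappa>_def)
  \<comment> \<open>The ball found below has radius \<open>r * \<rho>0\<close> and its centre is
    within \<open>r * D\<close> of \<open>x\<close>, so enlarging it by \<open>L\<close> reaches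
    \<open>x\<close> for every \<open>r\<close>.\<close>
  define L where "L = 1 + D / \<rho>0"
  have L: "L \<ge> 1" using D \<rho>0 by (simp add: L_def)
  show ?thesis
  proof (rule exI[of _ \<kappa>], intro conjI allI impI \<kappa>)
    fix T :: real assume T: "T \<ge> 0"
    \<comment> \<open>Bound for \<open>q / s\<close> at selected sample points:
      \<open>sqrt (T * B)\<close> from the small residual, the rest from the distance between error
      and polynomial.\<close>
    define G where "G = sqrt (T * B) + 1 + B + C0"
    have G: "G > 0" using T B C0 by (simp add: G_def add_nonneg_pos add_pos_nonneg)
    define C where "C = 1 + B + C0 + E * L ^ m * (2 * G)"
    have C: "C > 0" using B C0 E L G by (simp add: C_def add_pos_nonneg)
    show "\<exists>C>0. \<forall>n \<mu> X r k. \<mu> > 0 \<longrightarrow> 0 < r \<longrightarrow> r \<le> 1 \<longrightarrow> 0 < k \<longrightarrow> (\<forall>j<n. X j \<in> \<Omega>) \<longrightarrow>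
     (\<forall>u. cball u (\<kappa> * r) \<subseteq> \<Omega> \<longrightarrow> k \<le> real (card {j\<in>{..<n}. norm (X j - u) \<le> \<kappa> * r})) \<longrightarrow>
     \<mu> \<le> T * k * (r powr (\<nu> - real DIM('a) / 2))\<^sup>2 \<longrightarrow>
     (\<forall>x\<in>\<Omega>. \<bar>f x - krr_est \<Psi> \<mu> n X f x\<bar> \<le> C * r powr (\<nu> - real DIM('a) / 2))"
    proof (intro exI[of _ C] conjI allI impI ballI C)
      fix n and \<mu> :: real and X :: "nat \<Rightarrow> 'a" and r k :: real and x :: 'a
      assume \<mu>: "\<mu> > 0" and r: "0 < r" "r \<le> 1" and k: "0 < k" and X: "\<forall>j<n. X j \<in> \<Omega>"
        and spread: "\<forall>u. cball u (\<kappa> * r) \<subseteq> \<Omega> \<longrightarrow> k \<le> real (card {j\<in>{..<n}. norm (X j - u) \<le> \<kappa> * r})"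
        and \<mu>k: "\<mu> \<le> T * k * (r powr (\<nu> - real DIM('a) / 2))\<^sup>2" and x: "x \<in> \<Omega>"
      define s where "s = r powr (\<nu> - real DIM('a) / 2)"
      have s: "s > 0" using r by (simp add: s_def)
      define e where "e y = f y - krr_est \<Psi> \<mu> n X f y" for y
      \<comment> \<open>The tolerance is taken to be \<open>s\<close> itself, so the finite
        replacement costs no more than the claimed rate.\<close>
      obtain es where es: "knorm2 \<Psi> es \<le> B" "\<And>y. y \<in> insert x (X ` {..<n}) \<Longrightarrow> \<bar>kcomb \<Psi> es y - e y\<bar> < s"
        and esum: "(\<Sum>j<n. (e (X j))\<^sup>2) \<le> \<mu> * B"
        using appr[OF \<mu> s X x] unfolding e_def by blast
      obtain q :: "'a \<Rightarrow> complex" where q: "line_poly m q" "bounded (q ` cball x (D * r))"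
        and qn: "\<And>y. y \<in> cball x (D * r) \<Longrightarrow> cmod (complex_of_real (kcomb \<Psi> es y) - q y) \<le> (knorm2 \<Psi> es + C0) * s"
        using loc[OF r, of x es] unfolding s_def by blast
      have near: "cmod (complex_of_real (e y) - q y) \<le> (1 + B + C0) * s"
        if y: "y \<in> cball x (D * r)" "y \<in> insert x (X ` {..<n})" for y
      proof -
        have "cmod (complex_of_real (e y) - q y) \<le> cmod (complex_of_real (kcomb \<Psi> es y - e y)) + cmod (complex_of_real (kcomb \<Psi> es y) - q y)"
          by (rule order_trans[OF _ norm_triangle_ineq4]) (simp add: norm_minus_commute)
        also have "\<dots> \<le> s + (knorm2 \<Psi> es + C0) * s"
          using es(2)[OF y(2)] qn[OF y(1)] by (intro add_mono) (auto simp only: norm_of_real)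
        also have "\<dots> \<le> s + (B + C0) * s" using es(1) s by (intro add_left_mono mult_right_mono) auto
        finally show ?thesis by (simp add: algebra_simps)
      qed
      \<comment> \<open>The fixed ball in \<open>\<Omega>\<close>, contracted towards \<open>x\<close> by the factor \<open>r\<close>\<close>
      define c where "c = (1 - r) *\<^sub>R x + r *\<^sub>R c0"
      define \<rho> where "\<rho> = r * \<rho>0"
      have \<rho>: "\<rho> > 0" using r \<rho>0 by (simp add: \<rho>_def)
      have ball: "y \<in> \<Omega> \<and> y \<in> cball x (D * r)" if y: "y \<in> cball c \<rho>" for y
      proof -
        \<comment> \<open>The preimage of \<open>y\<close> under the contraction towards
          \<open>x\<close>. It lies in the fixed ball, so convexity puts \<open>y\<close> in
          \<open>\<Omega>\<close>, and the distance to \<open>x\<close> shrinks by the factor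
          \<open>r\<close>.\<close>
        define y' where "y' = c0 + (y - c) /\<^sub>R r"
        have "norm (y - c) \<le> r * \<rho>0" using y by (simp add: \<rho>_def dist_norm norm_minus_commute)
        then have "norm ((y - c) /\<^sub>R r) \<le> \<rho>0"
          using r by (simp add: divide_simps mult.commute)
        then have "y' \<in> \<Omega>" using c0 by (auto simp: y'_def dist_norm)
        moreover have yy: "y = (1 - r) *\<^sub>R x + r *\<^sub>R y'"
          using r by (simp add: y'_def c_def algebra_simps)
        ultimately have "y \<in> \<Omega>" using convexD[OF conv x, of y' "1 - r" r] r by simp
        moreover have "dist x y = r * dist x y'"
        proof -
          have "x - y = r *\<^sub>R (x - y')" unfolding yy by (simp add: algebra_simps)
          then show ?thesis using r by (simp add: dist_norm)
        qed
        moreover have "r * dist x y' \<le> r * D" using D(2)[OF x \<open>y' \<in> \<Omega>\<close>] r by (intro mult_left_mono) auto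
        ultimately show ?thesis by (simp add: mult.commute)
      qed
      have "\<exists>v\<in>cball c \<rho>. norm (u - v) \<le> \<epsilon> * \<rho> \<and> norm (q v) \<le> G * s" if u: "u \<in> cball c \<rho>" for u
      proof -
        \<comment> \<open>\<open>u\<close> is pulled towards the centre just enough that the cell of
          radius \<open>\<kappa> * r\<close>, which is \<open>\<epsilon> * \<rho> / 2\<close>, fits
          inside the ball.\<close>
        define u' where "u' = c + (1 - \<epsilon> / 2) *\<^sub>R (u - c)"
        have uc: "norm (u - c) \<le> \<rho>" using u by (simp add: dist_norm norm_minus_commute)
        have "u - u' = (\<epsilon> / 2) *\<^sub>R (u - c)" by (simp add: u'_def algebra_simps)
        then have uu: "norm (u - u') \<le> \<kappa> * r"
          using uc \<epsilon> by (simp add: \<kappa>_def \<rho>_def mult_ac)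
        have u'c: "norm (u' - c) \<le> (1 - \<epsilon> / 2) * \<rho>" using uc \<epsilon> by (simp add: u'_def mult_left_mono)
        have sub: "cball u' (\<kappa> * r) \<subseteq> cball c \<rho>"
        proof
          fix y assume "y \<in> cball u' (\<kappa> * r)"
          then have "dist c y \<le> (1 - \<epsilon> / 2) * \<rho> + \<kappa> * r"
            using u'c by (intro dist_triangle_le[of c u']) (auto simp: dist_norm norm_minus_commute intro: add_mono)
          then show "y \<in> cball c \<rho>" by (simp add: \<kappa>_def \<rho>_def algebra_simps)
        qed
        define J where "J = {j\<in>{..<n}. norm (X j - u') \<le> \<kappa> * r}"
        have "k \<le> real (card J)" using spread sub ball unfolding J_def by blast
        \<comment> \<open>Pigeonhole: the cell holds at least \<open>k\<close> sample points, while
          all squared residuals sum to at most \<open>\<mu> * B\<close>.\<close>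
        then have "\<exists>j\<in>J. (e (X j))\<^sup>2 \<le> \<mu> * B / k"
          using esum k \<mu> B by (intro exists_le_average[where I="{..<n}"]) (auto simp: J_def)
        then obtain j where j: "j \<in> J" "(e (X j))\<^sup>2 \<le> \<mu> * B / k" by blast
        note j(2)
        also have "\<mu> * B / k \<le> (T * k * s\<^sup>2) * B / k"
          using \<mu>k B k unfolding s_def by (intro divide_right_mono mult_right_mono) auto
        also have "\<dots> = (sqrt (T * B) * s)\<^sup>2" using k T B by (simp add: power_mult_distrib)
        finally have ej: "\<bar>e (X j)\<bar> \<le> sqrt (T * B) * s"
          using T B s by (intro power2_le_imp_le[of "\<bar>e (X j)\<bar>"]) auto
        have v: "X j \<in> cball u' (\<kappa> * r)" using j by (simp add: J_def dist_norm norm_minus_commute)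
        then have vc: "X j \<in> cball c \<rho>" using sub by blast
        have "norm (u - X j) \<le> norm (u - u') + norm (u' - X j)" using norm_triangle_ineq[of "u - u'" "u' - X j"] by simp
        also have "\<dots> \<le> \<kappa> * r + \<kappa> * r" using uu v by (intro add_mono) (auto simp: dist_norm)
        finally have uv: "norm (u - X j) \<le> \<epsilon> * \<rho>" by (simp add: \<kappa>_def \<rho>_def algebra_simps)
        have "cmod (q (X j)) \<le> \<bar>e (X j)\<bar> + cmod (complex_of_real (e (X j)) - q (X j))"
          using norm_triangle_sub[of "q (X j)" "complex_of_real (e (X j))"] by (simp add: norm_minus_commute)
        also have "\<dots> \<le> sqrt (T * B) * s + (1 + B + C0) * s"
          using ej near[of "X j"] ball[OF vc] j(1) by (intro add_mono) (auto simp: J_def)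
        also have "\<dots> = G * s" by (simp add: G_def algebra_simps)
        finally show ?thesis using vc uv by blast
      qed
      moreover have "bounded (q ` cball c \<rho>)"
        by (rule bounded_subset[OF q(2)]) (use ball in blast)
      ultimately have small: "\<forall>u\<in>cball c \<rho>. norm (q u) \<le> 2 * (G * s)"
        using norming[OF q(1) _ \<rho>] by blast
      \<comment> \<open>The point \<open>x\<close> may lie outside the contracted ball, for instance
        on the boundary of \<open>\<Omega>\<close>; extrapolation carries the bound over.\<close>
      have "x - c = r *\<^sub>R (x - c0)" by (simp add: c_def algebra_simps)
      then have "dist c x = r * dist c0 x" using r by (simp add: dist_norm norm_minus_commute[of _ x])
      also have "\<dots> \<le> r * D" using D(2)[OF c0\<Omega> x] r by (intro mult_left_mono) auto
      also have "\<dots> \<le> L * \<rho>" using r \<rho>0 by (simp add: L_def \<rho>_def field_simps)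
      finally have "x \<in> cball c (L * \<rho>)" by simp
      from ext[OF q(1) L small this] have qx: "cmod (q x) \<le> E * L ^ m * (2 * (G * s))" .
      have "\<bar>e x\<bar> = cmod (complex_of_real (e x))" by simp
      also have "\<dots> \<le> cmod (q x) + cmod (complex_of_real (e x) - q x)" by (rule norm_triangle_sub)
      also have "\<dots> \<le> E * L ^ m * (2 * (G * s)) + (1 + B + C0) * s"
        using qx near[of x] D r by (intro add_mono) auto
      also have "\<dots> = C * s" by (simp add: C_def algebra_simps)
      finally show "\<bar>f x - krr_est \<Psi> \<mu> n X f x\<bar> \<le> C * r powr (\<nu> - real DIM('a) / 2)"
        by (simp add: e_def s_def)
    qed
  qed
qed

end

section \<open>Auxiliary estimates and the choice of scale\<close>

text \<open>Absorbs the cardinality of the net into the exponential. With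
  \<open>p * K \<ge> 1\<close>, \<open>n\<close> is at most a constant times
  \<open>(y / K) ^ K\<close>, which is below \<open>exp y\<close>; this uses up half of the
  exponent.\<close>

lemma linear_times_exp_bound:
  fixes w p :: real
  assumes w: "w > 0" and p: "p > 0"
  shows "\<exists>C>0. \<forall>n\<ge>1. real n * exp (- (w * real n powr p)) \<le> C * exp (- (w / 2 * real n powr p))"
proof -
  define K where "K = nat \<lceil>1 / p\<rceil>"
  have "1 / p \<le> real K" unfolding K_def by linarith
  then have K: "1 \<le> p * real K" using p by (simp add: field_simps)
  have K0: "K > 0" using K by (cases K) auto
  define C where "C = (2 * real K / w) ^ K"
  have C: "C > 0" using w K0 by (simp add: C_def)
  show ?thesis
  proof (intro exI[of _ C] conjI allI impI C)
    fix n :: nat assume n: "n \<ge> 1"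
    define y where "y = w / 2 * real n powr p"
    have y: "y > 0" using w n by (simp add: y_def)
    have "real n = real n powr 1" using n by simp
    also have "\<dots> \<le> real n powr (p * real K)" using K n by (intro powr_mono) auto
    also have "\<dots> = (real n powr p) ^ K" using n by (simp add: powr_powr[symmetric] powr_realpow)
    also have "\<dots> = C * (y / real K) ^ K"
      using w K0 by (simp add: C_def y_def power_mult_distrib[symmetric])
    also have "\<dots> \<le> C * (1 + y / real K) ^ K"
      using C y by (intro mult_left_mono power_mono) auto
    also have "\<dots> \<le> C * exp y"
      using C y K0 by (intro mult_left_mono exp_ge_one_plus_x_over_n_power_n) auto
    finally have "real n * exp (- (2 * y)) \<le> C * exp y * exp (- (2 * y))" by (intro mult_right_mono) auto
    also have "\<dots> = C * exp (- y)" by (simp add: mult.assoc exp_add[symmetric])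
    finally show "real n * exp (- (w * real n powr p)) \<le> C * exp (- (w / 2 * real n powr p))"
      by (simp add: y_def)
  qed
qed

text \<open>Squaring preserves order only on nonnegative extended reals, so the essential supremum
  must first be shown nonnegative; this is where the positive measure of \<open>\<Omega>\<close>
  enters.\<close>

lemma esssup_abs_square_le:
  fixes g :: "'a::euclidean_space \<Rightarrow> real"
  assumes "emeasure lborel \<Omega> > 0" and \<Omega>: "\<Omega> \<in> sets borel"
    and g: "g \<in> borel_measurable (restrict_space lborel \<Omega>)"
    and "\<And>x. x \<in> \<Omega> \<Longrightarrow> \<bar>g x\<bar> \<le> b" and "b\<^sup>2 \<le> R"
  shows "(esssup (restrict_space lborel \<Omega>) (\<lambda>x. ereal \<bar>g x\<bar>))\<^sup>2 \<le> ereal R"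
proof -
  define M where "M = restrict_space lborel \<Omega>"
  have gm: "(\<lambda>x. ereal \<bar>g x\<bar>) \<in> borel_measurable M" using g unfolding M_def by measurable
  have sp: "space M = \<Omega>" by (simp add: M_def space_restrict_space)
  have "emeasure M (space M) \<noteq> 0"
    using assms(1) \<Omega> unfolding sp by (simp add: M_def emeasure_restrict_space)
  then have "0 = esssup M (\<lambda>_. 0::ereal)" by (simp add: esssup_const)
  also have "\<dots> \<le> esssup M (\<lambda>x. ereal \<bar>g x\<bar>)" by (intro esssup_mono) auto
  finally have lo: "0 \<le> esssup M (\<lambda>x. ereal \<bar>g x\<bar>)" .
  have hi: "esssup M (\<lambda>x. ereal \<bar>g x\<bar>) \<le> ereal b"
    by (intro esssup_I gm AE_I2) (use assms sp in auto)
  have "(esssup M (\<lambda>x. ereal \<bar>g x\<bar>))\<^sup>2 \<le> (ereal b)\<^sup>2"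
    using lo hi order_trans[OF lo hi] unfolding power2_eq_square by (intro ereal_mult_mono) auto
  also have "\<dots> \<le> ereal R" using assms(5) by (simp add: power2_eq_square)
  finally show ?thesis unfolding M_def .
qed

theorem theorem4p6:
  fixes \<Omega> :: "'a::euclidean_space set"
    and \<Psi> f\<Psi> :: "'a \<Rightarrow> real"
    and c1 c2 \<nu> \<alpha> :: real
    and \<mu> :: "nat \<Rightarrow> real"
    and f :: "'a \<Rightarrow> real"
  assumes "convex \<Omega>" and "compact \<Omega>" and "emeasure lborel \<Omega> > 0"
    and "strictly_pos_def \<Psi>" and "integrable lborel \<Psi>" and "\<Psi> 0 = 1"
    and "spectral_density \<Psi> f\<Psi>"
    and "0 < c1" and "c1 \<le> c2" and "\<nu> > real DIM('a) / 2"
    and "\<forall>\<omega>. c1 * (1 + norm \<omega> ^ 2) powr (- \<nu>) \<le> f\<Psi> \<omega> \<and>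
              f\<Psi> \<omega> \<le> c2 * (1 + norm \<omega> ^ 2) powr (- \<nu>)"
    and "\<forall>n. \<mu> n > 0"
    and "\<exists>a b. 0 < a \<and> 0 < b \<and> (\<forall>n\<ge>1. a * real n powr \<alpha> \<le> \<mu> n \<and> \<mu> n \<le> b * real n powr \<alpha>)"
    and "\<alpha> < 1"
    and "f \<in> native_space \<Psi> \<Omega>"
  shows "\<exists>C1 C2 C3 \<eta>1. C1 > 0 \<and> C2 > 0 \<and> C3 > 0 \<and> \<eta>1 > 0 \<and>
    (\<forall>n\<ge>1. \<exists>A \<in> sets (sample_space \<Omega> n).
       A \<subseteq> {X \<in> space (sample_space \<Omega> n).
              (esssup (restrict_space lborel \<Omega>) (\<lambda>x. ereal \<bar>f x - krr_est \<Psi> (\<mu> n) n X f x\<bar>)) ^ 2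
              \<le> ereal (C3 * max (real n powr ((\<alpha> - 1) * (1 - real DIM('a) / (2 * \<nu>))))
                                 (real n powr (- (1 - real DIM('a) / (2 * \<nu>)))))} \<and>
       measure (sample_space \<Omega> n) A \<ge> 1 - C1 * exp (- C2 * real n powr \<eta>1))"
proof -
  interpret sobolev_kernel \<Psi> f\<Psi> c1 c2 \<nu>
    using assms by unfold_locales auto
  define d where "d = real DIM('a)"
  define p where "p = 1 - d / (2 * \<nu>)"
  have d0: "d > 0" unfolding d_def by simp
  have p: "0 < p" "p < 1" using nu nu_pos d0 by (auto simp: p_def d_def field_simps)
  obtain b where ab: "0 < b" "\<And>n. n \<ge> 1 \<Longrightarrow> \<mu> n \<le> b * real n powr \<alpha>"
    using assms(13) by blast
  have \<Omega>b: "\<Omega> \<in> sets borel" using assms(2) by (simp add: borel_compact)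
  have \<Omega>fin: "emeasure lborel \<Omega> < \<infinity>" using emeasure_compact_finite[OF assms(2)] by simp
  have vol: "measure lborel \<Omega> > 0"
    using assms(3) \<Omega>fin by (simp add: measure_def enn2real_positive_iff)
  \<comment> \<open>A convex set with empty interior is negligible, so positive measure provides a
    ball inside \<open>\<Omega>\<close>.\<close>
  have "interior \<Omega> \<noteq> {}"
  proof
    assume "interior \<Omega> = {}"
    then have "negligible \<Omega>" using negligible_convex_interior[OF assms(1)] by simp
    then have "emeasure lborel \<Omega> = 0"
      using \<Omega>b by (simp add: negligible_iff_null_sets null_sets_def)
    then show False using assms(3) by simp
  qed
  then obtain c0 \<rho>0 where c0: "cball c0 \<rho>0 \<subseteq> \<Omega>" "\<rho>0 > 0"
    by (metis all_not_in_conv mem_interior_cball)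
  obtain D0 where D0: "\<Omega> \<subseteq> cball 0 D0" "D0 > 0"
    using compact_imp_bounded[OF assms(2)] by (auto simp: bounded_pos subset_iff)
  define D where "D = 2 * D0 + 1"
  have D: "dist x y \<le> D" if "x \<in> \<Omega>" "y \<in> \<Omega>" for x y
  proof -
    have "norm x \<le> D0" "norm y \<le> D0" using that D0 by auto
    then show ?thesis unfolding D_def dist_norm using norm_triangle_ineq4[of x y] by linarith
  qed
  have D1: "D \<ge> 1" using D0 by (simp add: D_def)
  obtain \<kappa> where \<kappa>: "\<kappa> > 0" and bound: "\<And>T. T \<ge> 0 \<Longrightarrow> \<exists>C>0. \<forall>n \<mu> X r k. \<mu> > 0 \<longrightarrow> 0 < r \<longrightarrow> r \<le> 1 \<longrightarrow> 0 < k \<longrightarrow>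
     (\<forall>j<n. X j \<in> \<Omega>) \<longrightarrow>
     (\<forall>u. cball u (\<kappa> * r) \<subseteq> \<Omega> \<longrightarrow> k \<le> real (card {j\<in>{..<n}. norm (X j - u) \<le> \<kappa> * r})) \<longrightarrow>
     \<mu> \<le> T * k * (r powr (\<nu> - real DIM('a) / 2))\<^sup>2 \<longrightarrow>
     (\<forall>x\<in>\<Omega>. \<bar>f x - krr_est \<Psi> \<mu> n X f x\<bar> \<le> C * r powr (\<nu> - real DIM('a) / 2))"
    using krr_sup_bound[OF assms(1) c0 D1 D assms(15)] by blast
  \<comment> \<open>The net will have mesh \<open>\<tau> * r\<close>; the factor
    \<open>d + 1\<close> lost in \<open>well_spread_event\<close> then gives exactly the cell radius
    \<open>\<kappa> * r\<close>.\<close>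
  define \<tau> where "\<tau> = \<kappa> / (d + 1)"
  have \<tau>: "\<tau> > 0" using \<kappa> d0 by (simp add: \<tau>_def)
  define w where "w = unit_ball_vol DIM('a) / measure lborel \<Omega> * \<tau> ^ DIM('a) / 4"
  have w: "w > 0" using vol \<tau> by (simp add: w_def)
  \<comment> \<open>Here \<open>T = b / w\<close>, the ratio between the bound
    \<open>b * n powr \<alpha>\<close> on the regularisation and the cell count
    \<open>w * n * r ^ DIM('a)\<close>.\<close>
  obtain C where C: "C > 0" and bnd: "\<And>n \<mu> X r k. \<mu> > 0 \<Longrightarrow> 0 < r \<Longrightarrow> r \<le> 1 \<Longrightarrow> 0 < k \<Longrightarrow>
     (\<forall>j<n. X j \<in> \<Omega>) \<Longrightarrow>
     (\<forall>u. cball u (\<kappa> * r) \<subseteq> \<Omega> \<longrightarrow> k \<le> real (card {j\<in>{..<n}. norm (X j - u) \<le> \<kappa> * r})) \<Longrightarrow>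
     \<mu> \<le> b / w * k * (r powr (\<nu> - real DIM('a) / 2))\<^sup>2 \<Longrightarrow>
     (\<forall>x\<in>\<Omega>. \<bar>f x - krr_est \<Psi> \<mu> n X f x\<bar> \<le> C * r powr (\<nu> - real DIM('a) / 2))"
    using bound[of "b / w"] ab(1) w by auto
  obtain C' where C': "C' > 0" and lin: "\<And>n. n \<ge> 1 \<Longrightarrow>
      real n * exp (- (w * real n powr p)) \<le> C' * exp (- (w / 2 * real n powr p))"
    using linear_times_exp_bound[OF w p(1)] by blast
  define H where "H = 2 * D0 / \<tau> + 3"
  have H: "H > 0" using D0 \<tau> by (simp add: H_def add_pos_pos)
  \<comment> \<open>On \<open>\<Omega>\<close>, \<open>f\<close> is a pointwise limit of kernel
    combinations, which inherit measurability from \<open>\<Psi>\<close>.\<close>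
  have fm: "f \<in> borel_measurable (restrict_space lborel \<Omega>)" and \<Psi>m: "\<Psi> \<in> borel_measurable borel"
  proof -
    show \<Psi>m: "\<Psi> \<in> borel_measurable borel" using borel_measurable_integrable[OF assms(5)] by simp
    obtain S :: "nat \<Rightarrow> (real \<times> 'a) list" where S: "\<And>x. x \<in> \<Omega> \<Longrightarrow> (\<lambda>m. kcomb \<Psi> (S m) x) \<longlonglongrightarrow> f x"
      using assms(15) unfolding native_space_def by blast
    have km: "kcomb \<Psi> cs \<in> borel_measurable borel" for cs
    proof (induction cs)
      case (Cons x cs)
      obtain a z where x: "x = (a, z)" by force
      note \<Psi>m[measurable] Cons[measurable]
      show ?case unfolding x by (simp cong: measurable_cong_simp)
    qed (simp cong: measurable_cong_simp)
    show "f \<in> borel_measurable (restrict_space lborel \<Omega>)"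
    proof (rule borel_measurable_LIMSEQ_metric)
      show "kcomb \<Psi> (S m) \<in> borel_measurable (restrict_space lborel \<Omega>)" for m
        by (rule measurable_restrict_space1) (use km in simp)
      show "(\<lambda>m. kcomb \<Psi> (S m) x) \<longlonglongrightarrow> f x" if "x \<in> space (restrict_space lborel \<Omega>)" for x
        using S that by (simp add: space_restrict_space)
    qed
  qed
  have em: "(\<lambda>x. f x - krr_est \<Psi> \<mu>' n X f x) \<in> borel_measurable (restrict_space lborel \<Omega>)" for \<mu>' n X
  proof (rule borel_measurable_diff[OF fm])
    note \<Psi>m[measurable]
    have "krr_est \<Psi> \<mu>' n X f \<in> borel_measurable borel"
      unfolding krr_est_def by measurable
    then show "krr_est \<Psi> \<mu>' n X f \<in> borel_measurable (restrict_space lborel \<Omega>)"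
      by (intro measurable_restrict_space1) simp
  qed
  show ?thesis
  proof (rule exI[of _ "H ^ DIM('a) * C'"], rule exI[of _ "w / 2"], rule exI[of _ "C\<^sup>2"],
      rule exI[of _ p], intro conjI allI impI)
    fix n :: nat assume n: "n \<ge> 1"
    \<comment> \<open>\<open>m\<close> is \<open>r\<close> to the power \<open>2 * \<nu>\<close>.
      The first entry balances the regularisation against the cell counts, the second ensures that
      these grow at least like \<open>n powr p\<close>; \<open>\<alpha> < 1\<close> gives
      \<open>r \<le> 1\<close>.\<close>
    define m where "m = max (real n powr (\<alpha> - 1)) (real n powr (- 1))"
    define r where "r = m powr (1 / (2 * \<nu>))"
    have m1: "m \<le> 1" "m > 0"
      using n assms(14) powr_mono[of "\<alpha> - 1" 0 "real n"] powr_mono[of "-1" 0 "real n"]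
      by (auto simp: m_def less_max_iff_disj)
    have r: "0 < r" "r \<le> 1" using m1 nu_pos by (auto simp: r_def intro!: powr_le1)
    have r2: "r powr (2 * \<nu>) = m" using m1 nu_pos by (simp add: r_def powr_powr)
    have rd: "r ^ DIM('a) = r powr d" using r by (simp add: d_def powr_realpow)
    have rp: "r powr (2 * \<nu> - d) = m powr p"
      using nu_pos by (simp add: r_def powr_powr p_def diff_divide_distrib)
    have rate: "m powr p = max (real n powr ((\<alpha> - 1) * p)) (real n powr (- p))"
    proof -
      have "m powr p = max ((real n powr (\<alpha> - 1)) powr p) ((real n powr (- 1)) powr p)"
      proof (cases "real n powr (\<alpha> - 1) \<le> real n powr (- 1)")
        case True
        then show ?thesis using powr_mono2[OF less_imp_le[OF p(1)] _ True] by (simp add: m_def max_def)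
      next
        case False
        then have "real n powr (- 1) \<le> real n powr (\<alpha> - 1)" by simp
        then show ?thesis using powr_mono2[OF less_imp_le[OF p(1)], of "real n powr (- 1)" "real n powr (\<alpha> - 1)"]
          by (simp add: m_def max_absorb1)
      qed
      then show ?thesis unfolding powr_powr by simp
    qed
    define k where "k = w * (real n * r ^ DIM('a))"
    have k: "k > 0" using w n r by (simp add: k_def)
    have rlow: "real n powr (- (1 / (2 * \<nu>))) \<le> r"
    proof -
      have "(real n powr (- 1)) powr (1 / (2 * \<nu>)) \<le> r"
        unfolding r_def using nu_pos by (intro powr_mono2) (auto simp: m_def)
      then show ?thesis unfolding powr_powr by simp
    qed
    have rdlow: "real n powr (- (d / (2 * \<nu>))) \<le> r ^ DIM('a)"
    proof -
      have "(real n powr (- (1 / (2 * \<nu>)))) powr d \<le> r powr d"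
        using rlow d0 by (intro powr_mono2) auto
      then show ?thesis unfolding rd by (simp add: powr_powr)
    qed
    have klow: "w * real n powr p \<le> k"
    proof -
      have "real n powr p = real n * real n powr (- (d / (2 * \<nu>)))"
        using n powr_add[of "real n" 1 "- (d / (2 * \<nu>))"] by (simp add: p_def)
      also have "\<dots> \<le> real n * r ^ DIM('a)" using rdlow by (intro mult_left_mono) auto
      finally show ?thesis unfolding k_def using w by (intro mult_left_mono) auto
    qed
    have l: "\<tau> * r > 0" using \<tau> r by simp
    have keq: "real n * (unit_ball_vol DIM('a) / measure lborel \<Omega>) * (\<tau> * r) ^ DIM('a) / 4 = k"
      by (simp add: k_def w_def power_mult_distrib)
    have leq: "(real DIM('a) + 1) * (\<tau> * r) = \<kappa> * r"
      using d0 by (simp add: \<tau>_def d_def field_simps)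
    obtain A where A: "A \<in> sets (sample_space \<Omega> n)"
      and Ap: "measure (sample_space \<Omega> n) A \<ge> 1 - (2 * D0 / (\<tau> * r) + 3) ^ DIM('a) * exp (- k)"
      and AX: "\<And>X. X \<in> A \<Longrightarrow> X \<in> space (sample_space \<Omega> n) \<and> (\<forall>j<n. X j \<in> \<Omega>) \<and>
      (\<forall>u. cball u (\<kappa> * r) \<subseteq> \<Omega> \<longrightarrow> k \<le> real (card {j\<in>{..<n}. norm (X j - u) \<le> \<kappa> * r}))"
      using well_spread_event[OF assms(2,3) l D0(1), of n] unfolding keq leq by blast
    have s2: "(r powr (\<nu> - real DIM('a) / 2))\<^sup>2 = m powr p"
    proof -
      have "(r powr (\<nu> - real DIM('a) / 2))\<^sup>2 = r powr (2 * \<nu> - d)"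
        by (simp add: power2_eq_square powr_add[symmetric] d_def)
      then show ?thesis by (simp add: rp)
    qed
    have "\<mu> n \<le> b * real n powr \<alpha>" using ab(2) n by blast
    also have "\<dots> = b * (real n * real n powr (\<alpha> - 1))"
      using n by (simp add: powr_diff)
    also have "\<dots> \<le> b * (real n * m)" using ab(1) by (intro mult_left_mono) (auto simp: m_def)
    \<comment> \<open>The exponent \<open>2 * \<nu>\<close> splits into \<open>d\<close> and
      \<open>2 * \<nu> - d\<close>: the first part joins \<open>n\<close> to form the cell count,
      the second is the squared rate.\<close>
    also have "m = r ^ DIM('a) * m powr p"
      using r2 powr_add[of r d "2 * \<nu> - d"] unfolding rd rp[symmetric] by simp
    also have "b * (real n * (r ^ DIM('a) * m powr p)) = b / w * k * (r powr (\<nu> - real DIM('a) / 2))\<^sup>2"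
      using w unfolding s2 k_def by simp
    finally have \<mu>k: "\<mu> n \<le> b / w * k * (r powr (\<nu> - real DIM('a) / 2))\<^sup>2" .
    have good: "(esssup (restrict_space lborel \<Omega>) (\<lambda>x. ereal \<bar>f x - krr_est \<Psi> (\<mu> n) n X f x\<bar>)) ^ 2
              \<le> ereal (C\<^sup>2 * max (real n powr ((\<alpha> - 1) * (1 - real DIM('a) / (2 * \<nu>))))
                                 (real n powr (- (1 - real DIM('a) / (2 * \<nu>)))))" if X: "X \<in> A" for X
    proof (rule esssup_abs_square_le[OF assms(3) \<Omega>b em])
      show "\<bar>f x - krr_est \<Psi> (\<mu> n) n X f x\<bar> \<le> C * r powr (\<nu> - real DIM('a) / 2)" if "x \<in> \<Omega>" for x
        using bnd[OF _ r k _ _ \<mu>k, of n X] AX[OF X] assms(12) that by blast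
      show "(C * r powr (\<nu> - real DIM('a) / 2))\<^sup>2 \<le> C\<^sup>2 * max (real n powr ((\<alpha> - 1) * (1 - real DIM('a) / (2 * \<nu>))))
                                 (real n powr (- (1 - real DIM('a) / (2 * \<nu>))))"
        unfolding power_mult_distrib s2 rate unfolding p_def d_def by simp
    qed
    \<comment> \<open>The net has at most \<open>(H / r) ^ DIM('a)\<close> points, and this is
      linear in \<open>n\<close> because \<open>r\<close> to the power \<open>-d\<close> is at most
      \<open>n powr (d / (2 * \<nu>))\<close> with exponent below 1.\<close>
    have "(2 * D0 / (\<tau> * r) + 3) ^ DIM('a) * exp (- k) \<le> H ^ DIM('a) * real n * exp (- (w * real n powr p))"
    proof (rule mult_mono)
      have "H / r = 2 * D0 / (\<tau> * r) + 3 / r" by (simp add: H_def add_divide_distrib)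
      moreover have "3 \<le> 3 / r" using r by (simp add: field_simps)
      ultimately have "2 * D0 / (\<tau> * r) + 3 \<le> H / r" by linarith
      then have "(2 * D0 / (\<tau> * r) + 3) ^ DIM('a) \<le> (H / r) ^ DIM('a)"
        using D0 l by (intro power_mono) auto
      also have "\<dots> = H ^ DIM('a) * inverse (r ^ DIM('a))" by (simp add: divide_inverse power_mult_distrib power_inverse)
      also have "\<dots> \<le> H ^ DIM('a) * real n"
      proof (rule mult_left_mono)
        have "inverse (r ^ DIM('a)) \<le> inverse (real n powr (- (d / (2 * \<nu>))))"
          using rdlow n by (intro le_imp_inverse_le) auto
        also have "\<dots> = real n powr (d / (2 * \<nu>))" by (simp add: powr_minus)
        also have "\<dots> \<le> real n powr 1" using n p(1) by (intro powr_mono) (auto simp: p_def)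
        finally show "inverse (r ^ DIM('a)) \<le> real n" using n by simp
      qed (use H in auto)
      finally show "(2 * D0 / (\<tau> * r) + 3) ^ DIM('a) \<le> H ^ DIM('a) * real n" .
    qed (use klow H in auto)
    also have "\<dots> \<le> H ^ DIM('a) * (C' * exp (- (w / 2 * real n powr p)))"
      unfolding mult.assoc using lin[OF n] H by (intro mult_left_mono) auto
    finally have "measure (sample_space \<Omega> n) A \<ge> 1 - H ^ DIM('a) * C' * exp (- (w / 2) * real n powr p)"
      using Ap by (simp add: mult.assoc)
    with A AX good show "\<exists>A\<in>sets (sample_space \<Omega> n).
       A \<subseteq> {X \<in> space (sample_space \<Omega> n).
              (esssup (restrict_space lborel \<Omega>) (\<lambda>x. ereal \<bar>f x - krr_est \<Psi> (\<mu> n) n X f x\<bar>)) ^ 2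
              \<le> ereal (C\<^sup>2 * max (real n powr ((\<alpha> - 1) * (1 - real DIM('a) / (2 * \<nu>))))
                                 (real n powr (- (1 - real DIM('a) / (2 * \<nu>)))))} \<and>
       measure (sample_space \<Omega> n) A \<ge> 1 - H ^ DIM('a) * C' * exp (- (w / 2) * real n powr p)"
      by (intro bexI[of _ A] conjI subsetI CollectI) auto
  qed (use H C' w C p in auto)
qed

end
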